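(* Let $T$ be a complete NIP theory with monster model $\mathcal U$. Let $A\subseteq B\subseteq\mathcal U$ be small sets and $a$ a (possibly infinite, small) tuple from $\mathcal U$. If $\mathrm{tp}(a/B)$ is compressible, then $\mathrm{tp}(a/A)$ is compressible up to $B$.
   Context: $T$ is a complete theory in a language $\mathcal L$, $\mathcal U$ a large saturated model; small means of cardinality $<|\mathcal U|$; $\vdash$ is implication in $\mathcal U$. $T$ is NIP if for every $\mathcal L$-formula $\phi(x,y)$ the family $\{\phi(\mathcal U^x,b):b\in\mathcal U^y\}$ has finite VC-dimension. A type $p(x)=\mathrm{tp}(a/B)$ is compressible if for every $\mathcal L$-formula $\phi(x,y)$ there is an $\mathcal L$-formula $\psi(x,z)$ such that for every finite $B_0\subseteq B$ there is $c\in B^z$ with $\mathcal U\vDash\psi(a,c)$ and $\psi(x,c)\vdash\{\phi(x,b):b\in B_0^y,\ \vDash\phi(a,b)\}\cup\{\neg\phi(x,b):b\in B_0^y,\ \vDash\neg\phi(a,b)\}$. $\mathrm{tp}(a/A)$ is compressible up to $B$ if it is compressible when computed in $\mathcal U_B$, the expansion of $\mathcal U$ by constants for the elements of $B$. Explicitly: for every $\mathcal L(B)$-formula $\phi(x,y)$ there is an $\mathcal L(B)$-formula $\psi(x,z)$ such that for every finite $A_0\subseteq A$ there is $c\in A^z$ with $\vDash\psi(a,c)$ and $\psi(x,c)\vdash\{\phi(x,b):b\in A_0^y,\ \vDash\phi(a,b)\}\cup\{\neg\phi(x,b):b\in A_0^y,\ \vDash\neg\phi(a,b)\}$. *)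

theory Defs
  imports Main "HOL-Library.FuncSet" "HOL-Library.Equipollence"
begin

text \<open>A symbol is a name together with an arity. Languages are sets of symbols, so
  that a language may have arbitrary (possibly empty) sets of function and relation symbols;
  constants are function symbols of arity 0.\<close>

record ('f, 'r) lang =
  funs :: "('f \<times> nat) set"
  rels :: "('r \<times> nat) set"

datatype ('f, 'v) tm = Var 'v | App 'f "('f, 'v) tm list"

datatype ('f, 'r, 'v) fm =
    Eqn "('f, 'v) tm" "('f, 'v) tm"
  | Rel 'r "('f, 'v) tm list"
  | Neg "('f, 'r, 'v) fm"
  | Conj "('f, 'r, 'v) fm" "('f, 'r, 'v) fm"
  | Ex 'v "('f, 'r, 'v) fm"

fun tm_in :: "('f, 'r) lang \<Rightarrow> ('f, 'v) tm \<Rightarrow> bool" where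
  "tm_in L (Var v) \<longleftrightarrow> True"
| "tm_in L (App f ts) \<longleftrightarrow> (f, length ts) \<in> funs L \<and> (\<forall>t\<in>set ts. tm_in L t)"

fun fm_in :: "('f, 'r) lang \<Rightarrow> ('f, 'r, 'v) fm \<Rightarrow> bool" where
  "fm_in L (Eqn s t) \<longleftrightarrow> tm_in L s \<and> tm_in L t"
| "fm_in L (Rel r ts) \<longleftrightarrow> (r, length ts) \<in> rels L \<and> (\<forall>t\<in>set ts. tm_in L t)"
| "fm_in L (Neg \<phi>) \<longleftrightarrow> fm_in L \<phi>"
| "fm_in L (Conj \<phi> \<psi>) \<longleftrightarrow> fm_in L \<phi> \<and> fm_in L \<psi>"
| "fm_in L (Ex v \<phi>) \<longleftrightarrow> fm_in L \<phi>"

fun tm_vars :: "('f, 'v) tm \<Rightarrow> 'v set" where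
  "tm_vars (Var v) = {v}"
| "tm_vars (App f ts) = (\<Union>t\<in>set ts. tm_vars t)"

fun free_vars :: "('f, 'r, 'v) fm \<Rightarrow> 'v set" where
  "free_vars (Eqn s t) = tm_vars s \<union> tm_vars t"
| "free_vars (Rel r ts) = (\<Union>t\<in>set ts. tm_vars t)"
| "free_vars (Neg \<phi>) = free_vars \<phi>"
| "free_vars (Conj \<phi> \<psi>) = free_vars \<phi> \<union> free_vars \<psi>"
| "free_vars (Ex v \<phi>) = free_vars \<phi> - {v}"

record ('f, 'r, 'u) struct =
  carrier :: "'u set"
  fun_int :: "'f \<Rightarrow> 'u list \<Rightarrow> 'u"
  rel_int :: "'r \<Rightarrow> 'u list \<Rightarrow> bool"

text \<open>The finite power \<open>X\<^sup>n\<close>; for \<open>n = 0\<close> it consists of the empty tuple only.\<close>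

definition tuples :: "'u set \<Rightarrow> nat \<Rightarrow> 'u list set" where
  "tuples X n = {us. length us = n \<and> set us \<subseteq> X}"

definition is_struct :: "('f, 'r) lang \<Rightarrow> ('f, 'r, 'u) struct \<Rightarrow> bool" where
  "is_struct L M \<longleftrightarrow> carrier M \<noteq> {} \<and>
     (\<forall>(f, n)\<in>funs L. \<forall>us\<in>tuples (carrier M) n. fun_int M f us \<in> carrier M)"

fun tm_val :: "('f, 'r, 'u) struct \<Rightarrow> ('v \<Rightarrow> 'u) \<Rightarrow> ('f, 'v) tm \<Rightarrow> 'u" where
  "tm_val M e (Var v) = e v"
| "tm_val M e (App f ts) = fun_int M f (map (tm_val M e) ts)"

fun sat :: "('f, 'r, 'u) struct \<Rightarrow> ('v \<Rightarrow> 'u) \<Rightarrow> ('f, 'r, 'v) fm \<Rightarrow> bool" where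
  "sat M e (Eqn s t) \<longleftrightarrow> tm_val M e s = tm_val M e t"
| "sat M e (Rel r ts) \<longleftrightarrow> rel_int M r (map (tm_val M e) ts)"
| "sat M e (Neg \<phi>) \<longleftrightarrow> \<not> sat M e \<phi>"
| "sat M e (Conj \<phi> \<psi>) \<longleftrightarrow> sat M e \<phi> \<and> sat M e \<psi>"
| "sat M e (Ex v \<phi>) \<longleftrightarrow> (\<exists>u\<in>carrier M. sat M (e(v := u)) \<phi>)"

definition sentence :: "('f, 'r) lang \<Rightarrow> ('f, 'r, nat) fm \<Rightarrow> bool" where
  "sentence L \<sigma> \<longleftrightarrow> fm_in L \<sigma> \<and> free_vars \<sigma> = {}"

definition is_model :: "('f, 'r) lang \<Rightarrow> ('f, 'r, 'u) struct \<Rightarrow> ('f, 'r, nat) fm set \<Rightarrow> bool" where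
  "is_model L M T \<longleftrightarrow> is_struct L M \<and> (\<forall>\<sigma>\<in>T. \<forall>e. (\<forall>v. e v \<in> carrier M) \<longrightarrow> sat M e \<sigma>)"

text \<open>Entailment and satisfiability quantify over models of \<open>T\<close>, which in HOL must have a fixed
  element type. The type of formulas is infinite and at least as large as the language, so by
  the downward Loewenheim-Skolem theorem models whose domain is a set of elements of that type
  suffice.\<close>

definition entails :: "('f, 'r) lang \<Rightarrow> ('f, 'r, nat) fm set \<Rightarrow> ('f, 'r, nat) fm \<Rightarrow> bool" where
  "entails L T \<sigma> \<longleftrightarrow>
     (\<forall>M :: ('f, 'r, ('f, 'r, nat) fm) struct. is_model L M T \<longrightarrow> is_model L M {\<sigma>})"

definition satisfiable :: "('f, 'r) lang \<Rightarrow> ('f, 'r, nat) fm set \<Rightarrow> bool" where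
  "satisfiable L T \<longleftrightarrow> (\<exists>M :: ('f, 'r, ('f, 'r, nat) fm) struct. is_model L M T)"

definition complete_theory :: "('f, 'r) lang \<Rightarrow> ('f, 'r, nat) fm set \<Rightarrow> bool" where
  "complete_theory L T \<longleftrightarrow> (\<forall>\<sigma>\<in>T. sentence L \<sigma>) \<and> satisfiable L T \<and>
     (\<forall>\<sigma>. sentence L \<sigma> \<longrightarrow> entails L T \<sigma> \<or> entails L T (Neg \<sigma>))"

text \<open>The language \<open>L(B)\<close> and the expansion of \<open>M\<close> in which each constant names itself. Which of
  the constants are available is governed by the language alone.\<close>

definition lang_consts :: "('f, 'r) lang \<Rightarrow> 'u set \<Rightarrow> ('f + 'u, 'r) lang" where
  "lang_consts L B = \<lparr> funs = {(Inl f, n) |f n. (f, n) \<in> funs L} \<union> {(Inr b, 0) |b. b \<in> B},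
                       rels = rels L \<rparr>"

definition struct_consts :: "('f, 'r, 'u) struct \<Rightarrow> ('f + 'u, 'r, 'u) struct" where
  "struct_consts M = \<lparr> carrier = carrier M,
                       fun_int = case_sum (fun_int M) (\<lambda>b us. b),
                       rel_int = rel_int M \<rparr>"

definition small :: "('f, 'r, 'u) struct \<Rightarrow> 'a set \<Rightarrow> bool" where
  "small M S \<longleftrightarrow> S \<prec> carrier M"

text \<open>Saturation in the cardinality of the model: every finitely satisfiable set of formulas in
  the single variable \<open>0\<close> over a small set of parameters is realised.\<close>

definition saturated :: "('f, 'r) lang \<Rightarrow> ('f, 'r, 'u) struct \<Rightarrow> bool" where
  "saturated L M \<longleftrightarrow>
     (\<forall>A p. A \<subseteq> carrier M \<and> small M A \<and>
        (\<forall>\<phi>\<in>p. fm_in (lang_consts L A) \<phi> \<and> free_vars \<phi> \<subseteq> {0 :: nat}) \<and>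
        (\<forall>p\<^sub>0. finite p\<^sub>0 \<and> p\<^sub>0 \<subseteq> p \<longrightarrow>
           (\<exists>u\<in>carrier M. \<forall>\<phi>\<in>p\<^sub>0. sat (struct_consts M) (\<lambda>_. u) \<phi>)) \<longrightarrow>
        (\<exists>u\<in>carrier M. \<forall>\<phi>\<in>p. sat (struct_consts M) (\<lambda>_. u) \<phi>))"

text \<open>``Large'' is read as: more elements than there are formulas. In particular the model is
  infinite.\<close>

definition monster_model :: "('f, 'r) lang \<Rightarrow> ('f, 'r, nat) fm set \<Rightarrow> ('f, 'r, 'u) struct \<Rightarrow> bool" where
  "monster_model L T U \<longleftrightarrow> is_model L U T \<and> saturated L U \<and>
     small U {\<phi> :: ('f, 'r, nat) fm. fm_in L \<phi>}"

text \<open>A partitioned formula \<open>\<phi>(x, y)\<close> has free variables \<open>Inl i\<close> with \<open>i \<in> I\<close> for the (possibly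
  infinite) tuple \<open>x\<close> and \<open>Inr 0, \<dots>, Inr (n - 1)\<close> for the finite tuple \<open>y\<close>; any variable
  may be used as a bound variable. Values of \<open>x\<close> are functions in \<open>I \<rightarrow> carrier M\<close>, of which only the
  restriction to \<open>I\<close> is relevant.\<close>

definition part_fm :: "('f, 'r) lang \<Rightarrow> 'i set \<Rightarrow> nat \<Rightarrow> ('f, 'r, 'i + nat) fm \<Rightarrow> bool" where
  "part_fm L I n \<phi> \<longleftrightarrow> fm_in L \<phi> \<and> free_vars \<phi> \<subseteq> Inl ` I \<union> Inr ` {..<n}"

definition holds ::
  "('f, 'r, 'u) struct \<Rightarrow> ('i \<Rightarrow> 'u) \<Rightarrow> ('f, 'r, 'i + nat) fm \<times> 'u list \<Rightarrow> bool" where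
  "holds M a = (\<lambda>(\<phi>, b). sat M (case_sum a (\<lambda>j. b ! j)) \<phi>)"

definition shatters :: "'a set set \<Rightarrow> 'a set \<Rightarrow> bool" where
  "shatters F S \<longleftrightarrow> (\<forall>S\<^sub>0\<subseteq>S. \<exists>X\<in>F. X \<inter> S = S\<^sub>0)"

definition finite_VC_dim :: "'a set set \<Rightarrow> bool" where
  "finite_VC_dim F \<longleftrightarrow> (\<exists>d. \<forall>S. shatters F S \<longrightarrow> finite S \<and> card S \<le> d)"

definition NIP :: "('f, 'r) lang \<Rightarrow> ('f, 'r, 'u) struct \<Rightarrow> bool" where
  "NIP L U \<longleftrightarrow>
     (\<forall>m n. \<forall>\<phi> :: ('f, 'r, nat + nat) fm. part_fm L {..<m} n \<phi> \<longrightarrow>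
        finite_VC_dim
          {{a \<in> tuples (carrier U) m. holds U (\<lambda>i. a ! i) (\<phi>, b)} |b. b \<in> tuples (carrier U) n})"

text \<open>\<open>\<psi>(x, c) \<turnstile> \<Sigma>(x)\<close> in \<open>M\<close>, where \<open>\<Sigma>\<close> is a set of formulas together with their parameters.\<close>

definition implies_in ::
  "('f, 'r, 'u) struct \<Rightarrow> 'i set \<Rightarrow> ('f, 'r, 'i + nat) fm \<times> 'u list \<Rightarrow>
   (('f, 'r, 'i + nat) fm \<times> 'u list) set \<Rightarrow> bool" where
  "implies_in M I \<theta> \<Sigma> \<longleftrightarrow> (\<forall>x\<in>I \<rightarrow> carrier M. holds M x \<theta> \<longrightarrow> (\<forall>\<sigma>\<in>\<Sigma>. holds M x \<sigma>))"

text \<open>\<open>compressible L M I a B\<close> states that \<open>tp(a/B)\<close>, computed in the \<open>L\<close>-structure \<open>M\<close>, is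
  compressible, where \<open>a\<close> is an \<open>I\<close>-indexed tuple.\<close>

definition compressible ::
  "('f, 'r) lang \<Rightarrow> ('f, 'r, 'u) struct \<Rightarrow> 'i set \<Rightarrow> ('i \<Rightarrow> 'u) \<Rightarrow> 'u set \<Rightarrow> bool" where
  "compressible L M I a B \<longleftrightarrow>
     (\<forall>n \<phi>. part_fm L I n \<phi> \<longrightarrow>
        (\<exists>m \<psi>. part_fm L I m \<psi> \<and>
           (\<forall>B\<^sub>0. finite B\<^sub>0 \<and> B\<^sub>0 \<subseteq> B \<longrightarrow>
              (\<exists>c\<in>tuples B m. holds M a (\<psi>, c) \<and>
                 implies_in M I (\<psi>, c)
                   ({(\<phi>, b) |b. b \<in> tuples B\<^sub>0 n \<and> holds M a (\<phi>, b)} \<union>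
                    {(Neg \<phi>, b) |b. b \<in> tuples B\<^sub>0 n \<and> \<not> holds M a (\<phi>, b)})))))"

definition compressible_up_to ::
  "('f, 'r) lang \<Rightarrow> ('f, 'r, 'u) struct \<Rightarrow> 'i set \<Rightarrow> ('i \<Rightarrow> 'u) \<Rightarrow> 'u set \<Rightarrow> 'u set \<Rightarrow> bool" where
  "compressible_up_to L M I a A B \<longleftrightarrow>
     compressible (lang_consts L B) (struct_consts M) I a A"

end

theory Submission
  imports Defs "HOL-Library.Countable"
begin

text \<open>Suppose \<open>tp(a/A)\<close> is not compressible up to \<open>B\<close>, say one cannot compress the instances of
  \<open>\<phi>(x, b)\<close> true of \<open>a\<close>, and let \<open>\<psi>(x, z)\<close> compress them over \<open>B\<close>. Then for all finitely many
  \<open>L(B)\<close>-formulas there is a finite part of \<open>A\<close> in which, over any later choice of parameters \<open>d\<close>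
  from \<open>A\<close>, some true instance \<open>\<phi>(x, b)\<close> is undecided by what these formulas say about \<open>a\<close> over \<open>d\<close>.
  Write \<open>\<zeta>(z, b)\<close> for \<open>\<psi>(x, z) \<turnstile> \<phi>(x, b)\<close> and choose \<open>b\<^sub>1, \<dots>, b\<^sub>M\<close> such that each is undecided
  over the others. Some \<open>c\<close> from \<open>B\<close> satisfies \<open>\<psi>(a, c)\<close> and all \<open>\<zeta>(c, b\<^sub>i)\<close>. One shows by induction
  on \<open>|S|\<close> that every \<open>S \<subseteq> {1, \<dots>, M}\<close> is \<open>{i. \<not> \<zeta>(z, b\<^sub>i)}\<close> for some \<open>z\<close> with \<open>\<psi>(a, z)\<close>, which
  contradicts NIP for \<open>\<zeta>\<close>.

  For the induction step take \<open>z\<close> for \<open>S - {i}\<close>. As \<open>\<phi>(x, b\<^sub>i)\<close> is undecided, there is \<open>z'\<close> realising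
  \<open>S\<close>, but with \<open>\<psi>(x', z')\<close> for another \<open>x'\<close>. If no such \<open>z'\<close> works for \<open>a\<close>, then \<open>a\<close> fails the formula
  \<open>\<omega>(x, b) = \<exists>z. \<psi>(x, z) \<and> z realises S\<close>, whereas all \<open>x\<close> with \<open>\<psi>(x, z')\<close> satisfy it. If this phenomenon
  could not be excluded by strengthening the conditions on \<open>z\<close>, it would recur independently over
  elements \<open>c\<close> of \<open>B\<close> and produce a set of arbitrary finite size shattered by \<open>\<omega>\<close>, again contradicting
  NIP. The strengthenings for \<open>S\<close> must be available for \<open>S - {i}\<close>, so they are made in the order of
  decreasing \<open>|S|\<close>.\<close>

section \<open>Substitution in formulas\<close>

lemma finite_tm_vars: "finite (tm_vars t)"
  by (induction t) auto

lemma finite_free_vars: "finite (free_vars \<phi>)"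
  by (induction \<phi>) (auto simp: finite_tm_vars)

lemma tm_val_cong: "(\<And>v. v \<in> tm_vars t \<Longrightarrow> e v = e' v) \<Longrightarrow> tm_val M e t = tm_val M e' t"
proof (induction t)
  case (App f ts)
  then have "map (tm_val M e) ts = map (tm_val M e') ts" by auto
  then show ?case by (metis tm_val.simps(2))
qed simp

lemma sat_cong: "(\<And>v. v \<in> free_vars \<phi> \<Longrightarrow> e v = e' v) \<Longrightarrow> sat M e \<phi> = sat M e' \<phi>"
proof (induction \<phi> arbitrary: e e')
  case (Eqn s t)
  then have "tm_val M e s = tm_val M e' s" "tm_val M e t = tm_val M e' t"
    by (auto intro!: tm_val_cong)
  then show ?case by simp
next
  case (Rel r ts)
  then have "map (tm_val M e) ts = map (tm_val M e') ts"
    by (auto intro!: tm_val_cong)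
  then show ?case by (metis sat.simps(2))
next
  case (Neg \<phi>)
  from Neg.IH[of e e'] Neg.prems show ?case by simp
next
  case (Conj \<phi> \<psi>)
  from Conj.IH(1)[of e e'] Conj.IH(2)[of e e'] Conj.prems show ?case by simp
next
  case (Ex v \<phi>)
  have "sat M (e(v := u)) \<phi> = sat M (e'(v := u)) \<phi>" for u
    by (rule Ex.IH) (use Ex.prems in auto)
  then show ?case by simp
qed

text \<open>The map \<open>\<kappa>\<close> on function symbols lets one substitution serve both for
  renaming variables within \<open>L\<close> and for moving from \<open>L\<close> to
  \<open>L(B)\<close>, where \<open>\<kappa>\<close> is \<open>Inl\<close>.\<close>

primrec tm_subst :: "('f \<Rightarrow> 'g) \<Rightarrow> ('v \<Rightarrow> ('g, 'w) tm) \<Rightarrow> ('f, 'v) tm \<Rightarrow> ('g, 'w) tm" where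
  "tm_subst \<kappa> \<sigma> (Var v) = \<sigma> v"
| "tm_subst \<kappa> \<sigma> (App f ts) = App (\<kappa> f) (map (tm_subst \<kappa> \<sigma>) ts)"

lemma tm_vars_subst: "tm_vars (tm_subst \<kappa> \<sigma> t) = (\<Union>v\<in>tm_vars t. tm_vars (\<sigma> v))"
  by (induction t) auto

lemma tm_in_subst:
  assumes "\<And>f n. (f, n) \<in> funs L \<Longrightarrow> (\<kappa> f, n) \<in> funs L'"
  shows "tm_in L t \<Longrightarrow> (\<And>v. v \<in> tm_vars t \<Longrightarrow> tm_in L' (\<sigma> v)) \<Longrightarrow> tm_in L' (tm_subst \<kappa> \<sigma> t)"
  by (induction t) (auto simp: assms)

lemma tm_val_subst:
  assumes "\<And>f us. fun_int N (\<kappa> f) us = fun_int M f us"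
  shows "tm_val N e (tm_subst \<kappa> \<sigma> t) = tm_val M (\<lambda>v. tm_val N e (\<sigma> v)) t"
proof (induction t)
  case (App f ts)
  then show ?case
    by (auto simp: assms intro!: arg_cong[of _ _ "fun_int M f"])
qed simp

text \<open>Phrased as an existence, so that bound variables can be renamed during the induction;
  the infinite supply of variables guarantees fresh ones.\<close>

lemma fm_subst_exists:
  fixes \<phi> :: "('f, 'r, 'v) fm" and \<sigma> :: "'v \<Rightarrow> ('g, 'w) tm"
    and M :: "('f, 'r, 'u) struct" and N :: "('g, 'r, 'u) struct"
  assumes inf: "infinite (UNIV :: 'w set)"
    and N: "carrier N = carrier M" "\<And>f us. fun_int N (\<kappa> f) us = fun_int M f us" "rel_int N = rel_int M"
    and L': "\<And>f n. (f, n) \<in> funs L \<Longrightarrow> (\<kappa> f, n) \<in> funs L'" "rels L \<subseteq> rels L'"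
  shows "fm_in L \<phi> \<Longrightarrow> (\<And>v. v \<in> free_vars \<phi> \<Longrightarrow> tm_in L' (\<sigma> v)) \<Longrightarrow>
    \<exists>\<phi>' :: ('g, 'r, 'w) fm. fm_in L' \<phi>' \<and> free_vars \<phi>' \<subseteq> (\<Union>v\<in>free_vars \<phi>. tm_vars (\<sigma> v)) \<and>
      (\<forall>e. sat N e \<phi>' \<longleftrightarrow> sat M (\<lambda>v. tm_val N e (\<sigma> v)) \<phi>)"
proof (induction \<phi> arbitrary: \<sigma>)
  case (Eqn s t)
  show ?case
    by (rule exI[of _ "Eqn (tm_subst \<kappa> \<sigma> s) (tm_subst \<kappa> \<sigma> t)"])
      (use Eqn in \<open>auto simp: tm_vars_subst tm_val_subst[where M=M, OF N(2)] intro!: tm_in_subst[OF L'(1)]\<close>)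
next
  case (Rel r ts)
  have "map (tm_val N e \<circ> tm_subst \<kappa> \<sigma>) ts = map (tm_val M (\<lambda>v. tm_val N e (\<sigma> v))) ts" for e
    by (simp add: tm_val_subst[where M=M, OF N(2)])
  then have "\<forall>e. sat N e (Rel r (map (tm_subst \<kappa> \<sigma>) ts)) \<longleftrightarrow> sat M (\<lambda>v. tm_val N e (\<sigma> v)) (Rel r ts)"
    by (simp only: sat.simps N(3) map_map simp_thms)
  moreover have "fm_in L' (Rel r (map (tm_subst \<kappa> \<sigma>) ts))"
    using Rel L'(2) by (auto intro!: tm_in_subst[OF L'(1)])
  ultimately show ?case
    by (intro exI[of _ "Rel r (map (tm_subst \<kappa> \<sigma>) ts)"]) (auto simp: tm_vars_subst)
next
  case (Neg \<phi>)
  have p: "fm_in L \<phi>" "\<And>v. v \<in> free_vars \<phi> \<Longrightarrow> tm_in L' (\<sigma> v)"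
    using Neg.prems by simp_all
  obtain \<phi>' where "fm_in L' \<phi>' \<and> free_vars \<phi>' \<subseteq> (\<Union>v\<in>free_vars \<phi>. tm_vars (\<sigma> v)) \<and>
      (\<forall>e. sat N e \<phi>' \<longleftrightarrow> sat M (\<lambda>v. tm_val N e (\<sigma> v)) \<phi>)"
    using Neg.IH[of \<sigma>, OF p] by blast
  then show ?case by (intro exI[of _ "Neg \<phi>'"]) simp
next
  case (Conj \<phi>1 \<phi>2)
  have p: "fm_in L \<phi>1" "\<And>v. v \<in> free_vars \<phi>1 \<Longrightarrow> tm_in L' (\<sigma> v)"
      "fm_in L \<phi>2" "\<And>v. v \<in> free_vars \<phi>2 \<Longrightarrow> tm_in L' (\<sigma> v)"
    using Conj.prems by simp_all
  obtain \<phi>1' where 1: "fm_in L' \<phi>1' \<and> free_vars \<phi>1' \<subseteq> (\<Union>v\<in>free_vars \<phi>1. tm_vars (\<sigma> v)) \<and>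
      (\<forall>e. sat N e \<phi>1' \<longleftrightarrow> sat M (\<lambda>v. tm_val N e (\<sigma> v)) \<phi>1)"
    using Conj.IH(1)[of \<sigma>, OF p(1,2)] by blast
  obtain \<phi>2' where 2: "fm_in L' \<phi>2' \<and> free_vars \<phi>2' \<subseteq> (\<Union>v\<in>free_vars \<phi>2. tm_vars (\<sigma> v)) \<and>
      (\<forall>e. sat N e \<phi>2' \<longleftrightarrow> sat M (\<lambda>v. tm_val N e (\<sigma> v)) \<phi>2)"
    using Conj.IH(2)[of \<sigma>, OF p(3,4)] by blast
  have "free_vars (Conj \<phi>1' \<phi>2') \<subseteq> (\<Union>v\<in>free_vars (Conj \<phi>1 \<phi>2). tm_vars (\<sigma> v))"
    using conjunct1[OF conjunct2[OF 1]] conjunct1[OF conjunct2[OF 2]] by (simp add: UN_Un) blast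
  with 1 2 show ?case by (intro exI[of _ "Conj \<phi>1' \<phi>2'"]) simp
next
  case (Ex v \<phi>)
  \<comment> \<open>Capture is avoided by renaming the bound variable to some \<open>w\<close> that
    occurs in no term substituted for another free variable of the body.\<close>
  have "finite (\<Union>v'\<in>free_vars \<phi> - {v}. tm_vars (\<sigma> v'))"
    by (simp add: finite_free_vars finite_tm_vars)
  then obtain w where w: "w \<notin> (\<Union>v'\<in>free_vars \<phi> - {v}. tm_vars (\<sigma> v'))"
    using ex_new_if_finite[OF inf] by blast
  define \<sigma>' where "\<sigma>' = \<sigma>(v := Var w)"
  have p: "fm_in L \<phi>" "\<And>v. v \<in> free_vars \<phi> \<Longrightarrow> tm_in L' (\<sigma>' v)"
    using Ex.prems by (simp_all add: \<sigma>'_def)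
  obtain \<phi>' where \<phi>': "fm_in L' \<phi>'" "free_vars \<phi>' \<subseteq> (\<Union>v\<in>free_vars \<phi>. tm_vars (\<sigma>' v))"
      "\<And>e. sat N e \<phi>' \<longleftrightarrow> sat M (\<lambda>v. tm_val N e (\<sigma>' v)) \<phi>"
    using Ex.IH[of \<sigma>', OF p] by blast
  have "sat M (\<lambda>v'. tm_val N (e(w := u)) (\<sigma>' v')) \<phi> = sat M ((\<lambda>v'. tm_val N e (\<sigma> v'))(v := u)) \<phi>" for e u
    by (rule sat_cong) (use w in \<open>auto simp: \<sigma>'_def intro!: tm_val_cong\<close>)
  then have "\<forall>e. sat N e (Ex w \<phi>') \<longleftrightarrow> sat M (\<lambda>v. tm_val N e (\<sigma> v)) (Ex v \<phi>)"
    by (simp add: \<phi>'(3) N(1))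
  moreover have "free_vars (Ex w \<phi>') \<subseteq> (\<Union>v\<in>free_vars (Ex v \<phi>). tm_vars (\<sigma> v))"
  proof
    fix w' assume "w' \<in> free_vars (Ex w \<phi>')"
    then obtain v' where "v' \<in> free_vars \<phi>" "w' \<in> tm_vars (\<sigma>' v')" "w' \<noteq> w" using \<phi>'(2) by auto
    then show "w' \<in> (\<Union>v\<in>free_vars (Ex v \<phi>). tm_vars (\<sigma> v))"
      by (cases "v' = v") (auto simp: \<sigma>'_def)
  qed
  ultimately show ?case using \<phi>'(1) by (intro exI[of _ "Ex w \<phi>'"]) simp
qed

text \<open>The map \<open>h\<close> need not be injective: identifying variables is needed when
  several of them stand for the same tuple entry.\<close>

lemma fm_rename_exists:
  fixes \<phi> :: "('f, 'r, 'v) fm" and h :: "'v \<Rightarrow> 'w"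
  assumes "infinite (UNIV :: 'w set)" "fm_in L \<phi>"
  shows "\<exists>\<phi>' :: ('f, 'r, 'w) fm. fm_in L \<phi>' \<and> free_vars \<phi>' \<subseteq> h ` free_vars \<phi> \<and>
      (\<forall>e. sat M e \<phi>' \<longleftrightarrow> sat M (\<lambda>v. e (h v)) \<phi>)"
proof -
  have "\<exists>\<phi>' :: ('f, 'r, 'w) fm. fm_in L \<phi>' \<and>
      free_vars \<phi>' \<subseteq> (\<Union>v\<in>free_vars \<phi>. tm_vars (Var (h v) :: ('f, 'w) tm)) \<and>
      (\<forall>e. sat M e \<phi>' \<longleftrightarrow> sat M (\<lambda>v. tm_val M e (Var (h v))) \<phi>)"
    by (rule fm_subst_exists[where \<kappa>="\<lambda>f. f" and L=L]) (use assms in simp_all)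
  then show ?thesis by (simp add: UNION_singleton_eq_range)
qed

section \<open>Constants from B as variables\<close>

lemma struct_consts_simps [simp]:
  "carrier (struct_consts M) = carrier M" "rel_int (struct_consts M) = rel_int M"
  "fun_int (struct_consts M) (Inl f) us = fun_int M f us" "fun_int (struct_consts M) (Inr b) us = b"
  by (simp_all add: struct_consts_def)

lemma lang_consts_simps [simp]:
  "rels (lang_consts L B) = rels L"
  "(Inl f, n) \<in> funs (lang_consts L B) \<longleftrightarrow> (f, n) \<in> funs L"
  "(Inr b, n) \<in> funs (lang_consts L B) \<longleftrightarrow> b \<in> B \<and> n = 0"
  by (auto simp: lang_consts_def)

text \<open>A constant \<open>b\<close> turns into a variable \<open>Inr b\<close> that is evaluated
  at \<open>b\<close>, so that an \<open>L(B)\<close>-formula becomes an \<open>L\<close>-formula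
  with parameters from \<open>B\<close>.\<close>

primrec tm_unconst :: "('f + 'u, 'v) tm \<Rightarrow> ('f, 'v + 'u) tm" where
  "tm_unconst (Var v) = Var (Inl v)"
| "tm_unconst (App f ts) = (case f of Inl g \<Rightarrow> App g (map tm_unconst ts) | Inr b \<Rightarrow> Var (Inr b))"

primrec fm_unconst :: "('f + 'u, 'r, 'v) fm \<Rightarrow> ('f, 'r, 'v + 'u) fm" where
  "fm_unconst (Eqn s t) = Eqn (tm_unconst s) (tm_unconst t)"
| "fm_unconst (Rel r ts) = Rel r (map tm_unconst ts)"
| "fm_unconst (Neg \<phi>) = Neg (fm_unconst \<phi>)"
| "fm_unconst (Conj \<phi> \<psi>) = Conj (fm_unconst \<phi>) (fm_unconst \<psi>)"
| "fm_unconst (Ex v \<phi>) = Ex (Inl v) (fm_unconst \<phi>)"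

lemma tm_in_unconst: "tm_in (lang_consts L B) t \<Longrightarrow> tm_in L (tm_unconst t)"
proof (induction t)
  case (App f ts)
  then show ?case by (cases f) simp_all
qed simp

lemma tm_vars_unconst:
  "tm_in (lang_consts L B) t \<Longrightarrow> tm_vars (tm_unconst t) \<subseteq> Inl ` tm_vars t \<union> Inr ` B"
proof (induction t)
  case (App f ts)
  show ?case
  proof (cases f)
    case (Inl g)
    have "tm_vars (tm_unconst t) \<subseteq> Inl ` (\<Union>t\<in>set ts. tm_vars t) \<union> Inr ` B" if "t \<in> set ts" for t
    proof -
      have "tm_vars (tm_unconst t) \<subseteq> Inl ` tm_vars t \<union> Inr ` B"
        using App.IH[OF that] App.prems that by simp
      also have "\<dots> \<subseteq> Inl ` (\<Union>t\<in>set ts. tm_vars t) \<union> Inr ` B"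
        by (intro Un_mono image_mono order_refl UN_upper that)
      finally show ?thesis .
    qed
    with Inl show ?thesis by (simp add: UN_subset_iff)
  next
    case (Inr b)
    with App.prems show ?thesis by simp
  qed
qed simp

lemma tm_val_unconst:
  fixes M :: "('f, 'r, 'u) struct"
  shows "tm_in (lang_consts L B) t \<Longrightarrow>
    tm_val M (case_sum e (\<lambda>b. b)) (tm_unconst t) = tm_val (struct_consts M) e t"
proof (induction t)
  case (App f ts)
  show ?case
  proof (cases f)
    case (Inl g)
    have "map (tm_val M (case_sum e (\<lambda>b. b)) \<circ> tm_unconst) ts = map (tm_val (struct_consts M) e) ts"
      using App by simp
    then show ?thesis by (simp add: Inl del: map_eq_conv)
  next
    case (Inr b)
    then show ?thesis by simp
  qed
qed simp

lemma fm_in_unconst: "fm_in (lang_consts L B) \<phi> \<Longrightarrow> fm_in L (fm_unconst \<phi>)"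
  by (induction \<phi>) (simp_all add: tm_in_unconst[of L B])

lemma free_vars_unconst:
  "fm_in (lang_consts L B) \<phi> \<Longrightarrow> free_vars (fm_unconst \<phi>) \<subseteq> Inl ` free_vars \<phi> \<union> Inr ` B"
proof (induction \<phi>)
  case (Eqn s t)
  then show ?case using tm_vars_unconst[of L B s] tm_vars_unconst[of L B t] by auto
next
  case (Rel r ts)
  have "tm_vars (tm_unconst t) \<subseteq> Inl ` (\<Union>t\<in>set ts. tm_vars t) \<union> Inr ` B" if "t \<in> set ts" for t
  proof -
    have "tm_vars (tm_unconst t) \<subseteq> Inl ` tm_vars t \<union> Inr ` B"
      using tm_vars_unconst[of L B t] Rel.prems that by simp
    also have "\<dots> \<subseteq> Inl ` (\<Union>t\<in>set ts. tm_vars t) \<union> Inr ` B"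
      by (intro Un_mono image_mono order_refl UN_upper that)
    finally show ?thesis .
  qed
  then show ?case by (simp add: UN_subset_iff)
qed auto

lemma sat_unconst:
  fixes M :: "('f, 'r, 'u) struct"
  shows "fm_in (lang_consts L B) \<phi> \<Longrightarrow>
    sat M (case_sum e (\<lambda>b. b)) (fm_unconst \<phi>) = sat (struct_consts M) e \<phi>"
proof (induction \<phi> arbitrary: e)
  case (Eqn s t)
  then show ?case by (simp add: tm_val_unconst[of L B])
next
  case (Rel r ts)
  then have "map (tm_val M (case_sum e (\<lambda>b. b)) \<circ> tm_unconst) ts = map (tm_val (struct_consts M) e) ts"
    by (simp add: tm_val_unconst[of L B])
  then show ?case
    by (simp del: map_eq_conv)
next
  case (Ex v \<phi>)
  have "(case_sum e (\<lambda>b. b))(Inl v := u) = case_sum (e(v := u)) (\<lambda>b. b)" for u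
    by (auto simp: fun_eq_iff split: sum.splits)
  with Ex show ?case by simp
qed simp_all

section \<open>Definable predicates\<close>

text \<open>Variables for the tuple \<open>x\<close>, for a parameter tuple \<open>z\<close> from \<open>B\<close>, for the tuples \<open>b\<^sub>1, \<dots>, b\<^sub>M\<close> from
  \<open>A\<close> and for further parameters \<open>d\<close> from \<open>A\<close>. All these tuples are treated as infinite; a formula
  uses only finitely many of their entries.\<close>

datatype 'i pvar = XV 'i | ZV nat | YV nat nat | DV nat

locale definability =
  fixes L :: "('f, 'r) lang" and U :: "('f, 'r, 'u) struct" and I :: "'i set" and B :: "'u set"
  assumes carrier_ne: "carrier U \<noteq> {}" and B_carrier: "B \<subseteq> carrier U"
begin

definition okvars :: "('i pvar + 'u) set" where
  "okvars = Inl ` {v. case v of XV i \<Rightarrow> i \<in> I | _ \<Rightarrow> True} \<union> Inr ` B"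

text \<open>These are the predicates given by \<open>L(B)\<close>-formulas: an
  \<open>L\<close>-formula together with a map \<open>g\<close> that tells for each variable which
  tuple entry or which constant from \<open>B\<close> it stands for.\<close>

definition dfn :: "(('i pvar \<Rightarrow> 'u) \<Rightarrow> bool) \<Rightarrow> bool" where
  "dfn R \<longleftrightarrow> (\<exists>(\<phi> :: ('f, 'r, nat) fm) g. fm_in L \<phi> \<and> (\<forall>n. g n \<in> okvars) \<and>
     R = (\<lambda>e. sat U (\<lambda>n. case_sum e (\<lambda>b. b) (g n)) \<phi>))"

lemma okvars_simps [simp]:
  "Inl (XV i) \<in> okvars \<longleftrightarrow> i \<in> I" "Inl (ZV j) \<in> okvars" "Inl (YV k j) \<in> okvars"
  "Inl (DV j) \<in> okvars" "Inr b \<in> okvars \<longleftrightarrow> b \<in> B"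
  by (auto simp: okvars_def)

lemma dfn_formula:
  fixes \<phi> :: "('f, 'r, 'v) fm"
  assumes "fm_in L \<phi>" "k ` free_vars \<phi> \<subseteq> okvars"
  shows "dfn (\<lambda>e. sat U (\<lambda>v. case_sum e (\<lambda>b. b) (k v)) \<phi>)"
proof -
  obtain h :: "'v \<Rightarrow> nat" where h: "inj_on h (free_vars \<phi>)"
    using finite_imp_inj_to_nat_seg[OF finite_free_vars[of \<phi>]] by blast
  \<comment> \<open>Only the values on the image of the free variables matter; \<open>ZV 0\<close>
    is an arbitrary admissible default.\<close>
  define g where "g = (\<lambda>n. if n \<in> h ` free_vars \<phi> then k (inv_into (free_vars \<phi>) h n) else Inl (ZV 0))"
  obtain \<phi>' :: "('f, 'r, nat) fm" where \<phi>': "fm_in L \<phi>'" "\<And>e. sat U e \<phi>' \<longleftrightarrow> sat U (\<lambda>v. e (h v)) \<phi>"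
    using fm_rename_exists[OF infinite_UNIV_nat assms(1), of h U] by blast
  have "\<forall>n. g n \<in> okvars"
    using assms(2) by (auto simp: g_def inv_into_into)
  moreover have "sat U (\<lambda>v. case_sum e (\<lambda>b. b) (k v)) \<phi> = sat U (\<lambda>n. case_sum e (\<lambda>b. b) (g n)) \<phi>'" for e
    unfolding \<phi>'(2) by (rule sat_cong) (simp add: g_def h)
  ultimately show ?thesis
    unfolding dfn_def using \<phi>'(1) by (intro exI[of _ \<phi>'] exI[of _ g]) simp
qed

text \<open>Quantifying over an infinite tuple and counting instances over a finite set both reduce
  to these finitely many entries.\<close>

lemma dfn_support:
  assumes "dfn R"
  obtains S where "finite S" "\<And>e e'. (\<And>v. v \<in> S \<Longrightarrow> e v = e' v) \<Longrightarrow> R e = R e'"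
proof -
  obtain \<phi> :: "('f, 'r, nat) fm" and g where R: "R = (\<lambda>e. sat U (\<lambda>n. case_sum e (\<lambda>b. b) (g n)) \<phi>)"
    using assms unfolding dfn_def by blast
  define S where "S = {v. Inl v \<in> g ` free_vars \<phi>}"
  have "Inl ` S \<subseteq> g ` free_vars \<phi>" by (auto simp: S_def)
  then have "finite S"
    by (meson finite_free_vars finite_imageD finite_imageI finite_subset inj_Inl inj_on_subset subset_UNIV)
  moreover have "R e = R e'" if "\<And>v. v \<in> S \<Longrightarrow> e v = e' v" for e e'
    unfolding R
  proof (rule sat_cong)
    fix n assume "n \<in> free_vars \<phi>"
    then show "case_sum e (\<lambda>b. b) (g n) = case_sum e' (\<lambda>b. b) (g n)"
      using that imageI[of n "free_vars \<phi>" g] by (cases "g n") (simp_all add: S_def)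
  qed
  ultimately show ?thesis by (rule that)
qed

lemma dfn_const: "dfn (\<lambda>_. b)"
proof -
  have "dfn (\<lambda>e. sat U (\<lambda>v. case_sum e (\<lambda>b. b) (Inl (ZV 0))) (if b then Eqn (Var ()) (Var ()) else Neg (Eqn (Var ()) (Var ()))))"
    by (rule dfn_formula) auto
  moreover have "sat U e' (if b then Eqn (Var ()) (Var ()) else Neg (Eqn (Var ()) (Var ()))) = b" for e'
    by simp
  ultimately show ?thesis by simp
qed

lemma dfn_neg: "dfn R \<Longrightarrow> dfn (\<lambda>e. \<not> R e)"
  unfolding dfn_def
proof (elim exE conjE)
  fix \<phi> :: "('f, 'r, nat) fm" and g
  assume "fm_in L \<phi>" "\<forall>n. g n \<in> okvars" "R = (\<lambda>e. sat U (\<lambda>n. case_sum e (\<lambda>b. b) (g n)) \<phi>)"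
  then show "\<exists>(\<phi> :: ('f, 'r, nat) fm) g. fm_in L \<phi> \<and> (\<forall>n. g n \<in> okvars) \<and>
     (\<lambda>e. \<not> R e) = (\<lambda>e. sat U (\<lambda>n. case_sum e (\<lambda>b. b) (g n)) \<phi>)"
    by (intro exI[of _ "Neg \<phi>"] exI[of _ g]) simp
qed

lemma dfn_conj:
  assumes "dfn R" "dfn S"
  shows "dfn (\<lambda>e. R e \<and> S e)"
proof -
  obtain \<phi> :: "('f, 'r, nat) fm" and g where 1: "fm_in L \<phi>" "\<forall>n. g n \<in> okvars"
      "R = (\<lambda>e. sat U (\<lambda>n. case_sum e (\<lambda>b. b) (g n)) \<phi>)"
    using assms(1) unfolding dfn_def by blast
  obtain \<psi> :: "('f, 'r, nat) fm" and h where 2: "fm_in L \<psi>" "\<forall>n. h n \<in> okvars"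
      "S = (\<lambda>e. sat U (\<lambda>n. case_sum e (\<lambda>b. b) (h n)) \<psi>)"
    using assms(2) unfolding dfn_def by blast
  \<comment> \<open>Both formulas may use the same number for different entries, so their variables
    are first separated into two copies of the naturals.\<close>
  have inf: "infinite (UNIV :: (nat + nat) set)" by (simp add: infinite_UNIV_nat)
  obtain \<phi>' :: "('f, 'r, nat + nat) fm" where \<phi>': "fm_in L \<phi>'" "\<And>e. sat U e \<phi>' \<longleftrightarrow> sat U (\<lambda>v. e (Inl v)) \<phi>"
    using fm_rename_exists[OF inf 1(1), of Inl U] by blast
  obtain \<psi>' :: "('f, 'r, nat + nat) fm" where \<psi>': "fm_in L \<psi>'" "\<And>e. sat U e \<psi>' \<longleftrightarrow> sat U (\<lambda>v. e (Inr v)) \<psi>"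
    using fm_rename_exists[OF inf 2(1), of Inr U] by blast
  have "dfn (\<lambda>e. sat U (\<lambda>v. case_sum e (\<lambda>b. b) (case_sum g h v)) (Conj \<phi>' \<psi>'))"
    by (rule dfn_formula) (use 1 2 \<phi>' \<psi>' in \<open>auto split: sum.splits\<close>)
  then show ?thesis by (simp add: 1(3) 2(3) \<phi>'(2) \<psi>'(2))
qed

lemma dfn_subst:
  assumes "dfn R" and "\<And>v. Inl v \<in> okvars \<Longrightarrow> k v \<in> okvars"
  shows "dfn (\<lambda>e. R (\<lambda>v. case_sum e (\<lambda>b. b) (k v)))"
proof -
  obtain \<phi> :: "('f, 'r, nat) fm" and g where 1: "fm_in L \<phi>" "\<forall>n. g n \<in> okvars"
      "R = (\<lambda>e. sat U (\<lambda>n. case_sum e (\<lambda>b. b) (g n)) \<phi>)"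
    using assms(1) unfolding dfn_def by blast
  define h where "h n = case_sum k Inr (g n)" for n
  have "h n \<in> okvars" for n
    using 1(2)[rule_format, of n] assms(2) by (cases "g n") (auto simp: h_def)
  then have "dfn (\<lambda>e. sat U (\<lambda>v. case_sum e (\<lambda>b. b) (h v)) \<phi>)"
    by (intro dfn_formula 1) auto
  moreover have "case_sum (\<lambda>v. case_sum e (\<lambda>b. b) (k v)) (\<lambda>b. b) (g n) = case_sum e (\<lambda>b. b) (h n)" for n e
    by (cases "g n") (auto simp: h_def)
  ultimately show ?thesis by (simp add: 1(3))
qed

lemma dfn_ex1:
  assumes "dfn R"
  shows "dfn (\<lambda>e. \<exists>u\<in>carrier U. R (e(v := u)))"
proof -
  obtain \<phi> :: "('f, 'r, nat) fm" and g where 1: "fm_in L \<phi>" "\<forall>n. g n \<in> okvars"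
      "R = (\<lambda>e. sat U (\<lambda>n. case_sum e (\<lambda>b. b) (g n)) \<phi>)"
    using assms(1) unfolding dfn_def by blast
  \<comment> \<open>Several variables may stand for the entry \<open>v\<close>; all of them are
    identified with 0, which is then quantified.\<close>
  define h where "h n = (if g n = Inl v then 0 else Suc n)" for n
  obtain \<phi>' :: "('f, 'r, nat) fm" where \<phi>': "fm_in L \<phi>'" "\<And>e. sat U e \<phi>' \<longleftrightarrow> sat U (\<lambda>n. e (h n)) \<phi>"
    using fm_rename_exists[OF infinite_UNIV_nat 1(1), of h U] by blast
  define k where "k n = (case n of 0 \<Rightarrow> Inl (ZV 0) | Suc m \<Rightarrow> g m)" for n
  have "dfn (\<lambda>e. sat U (\<lambda>n. case_sum e (\<lambda>b. b) (k n)) (Ex 0 \<phi>'))"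
    by (rule dfn_formula) (use 1 \<phi>' in \<open>auto simp: k_def split: nat.splits\<close>)
  moreover have "sat U (\<lambda>n. case_sum e (\<lambda>b. b) (k n)) (Ex 0 \<phi>') \<longleftrightarrow> (\<exists>u\<in>carrier U. R (e(v := u)))" for e
  proof -
    have "sat U ((\<lambda>n. case_sum e (\<lambda>b. b) (k n))(0 := u)) \<phi>' = R (e(v := u))" for u
      unfolding \<phi>'(2) 1(3)
      by (rule sat_cong) (auto simp: h_def k_def split: sum.splits)
    then show ?thesis by simp
  qed
  ultimately show ?thesis by simp
qed

text \<open>The set \<open>W\<close> may be infinite, but only its intersection with a finite
  support matters, and those entries are quantified one at a time.\<close>

lemma dfn_exW:
  assumes "dfn R"
  shows "dfn (\<lambda>e. \<exists>e'. (\<forall>v. e' v \<in> carrier U) \<and> R (\<lambda>v. if v \<in> W then e' v else e v))"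
proof -
  obtain S where S: "finite S" "\<And>e e'. (\<And>v. v \<in> S \<Longrightarrow> e v = e' v) \<Longrightarrow> R e = R e'"
    using dfn_support[OF assms] by blast
  obtain u0 where u0: "u0 \<in> carrier U" using carrier_ne by blast
  have "finite F \<Longrightarrow> dfn (\<lambda>e. \<exists>e'. (\<forall>v. e' v \<in> carrier U) \<and> R (\<lambda>v. if v \<in> F then e' v else e v))" for F
  proof (induction F rule: finite_induct)
    case empty
    have "\<exists>e' :: 'i pvar \<Rightarrow> 'u. \<forall>v. e' v \<in> carrier U" using u0 by (intro exI[of _ "\<lambda>_. u0"]) simp
    then show ?case using assms by simp
  next
    case (insert w F)
    have "(\<exists>u\<in>carrier U. \<exists>e'. (\<forall>v. e' v \<in> carrier U) \<and> R (\<lambda>v. if v \<in> F then e' v else (e(w := u)) v)) \<longleftrightarrow>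
        (\<exists>e'. (\<forall>v. e' v \<in> carrier U) \<and> R (\<lambda>v. if v \<in> insert w F then e' v else e v))" (is "?l \<longleftrightarrow> ?r") for e
    proof
      assume ?l
      then obtain u e' where u: "u \<in> carrier U" "\<forall>v. e' v \<in> carrier U"
          "R (\<lambda>v. if v \<in> F then e' v else (e(w := u)) v)" by blast
      moreover have "(\<lambda>v. if v \<in> F then e' v else (e(w := u)) v) =
          (\<lambda>v. if v \<in> insert w F then (e'(w := u)) v else e v)"
        using insert.hyps by auto
      ultimately show ?r by (intro exI[of _ "e'(w := u)"]) auto
    next
      assume ?r
      then obtain e' where "\<forall>v. e' v \<in> carrier U" "R (\<lambda>v. if v \<in> insert w F then e' v else e v)" by blast
      moreover have "(\<lambda>v. if v \<in> F then e' v else (e(w := e' w)) v) =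
          (\<lambda>v. if v \<in> insert w F then e' v else e v)"
        using insert.hyps by auto
      ultimately show ?l by (intro bexI[of _ "e' w"] exI[of _ e']) auto
    qed
    with dfn_ex1[OF insert.IH, of w] show ?case by simp
  qed
  from this[of "S \<inter> W"] S(1)
  have "dfn (\<lambda>e. \<exists>e'. (\<forall>v. e' v \<in> carrier U) \<and> R (\<lambda>v. if v \<in> S \<inter> W then e' v else e v))" by simp
  moreover have "R (\<lambda>v. if v \<in> S \<inter> W then e' v else e v) = R (\<lambda>v. if v \<in> W then e' v else e v)" for e e'
    by (rule S(2)) auto
  ultimately show ?thesis by simp
qed

text \<open>NIP for predicates: the entries in \<open>W\<close> come from the parameter
  \<open>q\<close> of the family, the remaining ones from the points \<open>p k\<close>.\<close>

lemma dfn_nip: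
  assumes "NIP L U" "dfn R"
  shows "\<exists>N :: nat. \<forall>p. (\<forall>k<N. \<forall>v. p k v \<in> carrier U) \<longrightarrow>
    \<not> (\<forall>E\<subseteq>{..<N}. \<exists>q. (\<forall>v. q v \<in> carrier U) \<and> (\<forall>k<N. R (\<lambda>v. if v \<in> W then q v else p k v) \<longleftrightarrow> k \<in> E))"
proof -
  obtain \<phi> :: "('f, 'r, nat) fm" and g where 1: "fm_in L \<phi>" "\<forall>n. g n \<in> okvars"
      "R = (\<lambda>e. sat U (\<lambda>n. case_sum e (\<lambda>b. b) (g n)) \<phi>)"
    using assms(2) unfolding dfn_def by blast
  obtain K where K: "free_vars \<phi> \<subseteq> {..<K}"
    using finite_free_vars[of \<phi>] finite_nat_iff_bounded by blast
  \<comment> \<open>The partition of the variables: constants are placed on the side of the family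
    parameter.\<close>
  define h :: "nat \<Rightarrow> nat + nat" where
    "h n = (case g n of Inl v \<Rightarrow> if v \<in> W then Inr n else Inl n | Inr b \<Rightarrow> Inr n)" for n
  have inf: "infinite (UNIV :: (nat + nat) set)" by (simp add: infinite_UNIV_nat)
  obtain \<phi>' :: "('f, 'r, nat + nat) fm" where \<phi>': "fm_in L \<phi>'" "free_vars \<phi>' \<subseteq> h ` free_vars \<phi>"
      "\<And>e. sat U e \<phi>' \<longleftrightarrow> sat U (\<lambda>n. e (h n)) \<phi>"
    using fm_rename_exists[OF inf 1(1), of h U] by blast
  have "h n \<in> Inl ` {..<K} \<union> Inr ` {..<K}" if "n \<in> free_vars \<phi>" for n
    using that K by (auto simp: h_def split: sum.splits)
  then have "part_fm L {..<K} K \<phi>'"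
    using \<phi>' unfolding part_fm_def by blast
  then have "finite_VC_dim {{a \<in> tuples (carrier U) K. holds U (\<lambda>i. a ! i) (\<phi>', b)} |b. b \<in> tuples (carrier U) K}"
    using assms(1) unfolding NIP_def by blast
  then obtain d where d: "\<And>S. shatters {{a \<in> tuples (carrier U) K. holds U (\<lambda>i. a ! i) (\<phi>', b)} |b. b \<in> tuples (carrier U) K} S \<Longrightarrow>
      finite S \<and> card S \<le> d"
    unfolding finite_VC_dim_def by blast
  have contra: False if p: "\<forall>k<Suc d. \<forall>v. p k v \<in> carrier U"
    and E: "\<forall>E\<subseteq>{..<Suc d}. \<exists>q. (\<forall>v. q v \<in> carrier U) \<and> (\<forall>k<Suc d. R (\<lambda>v. if v \<in> W then q v else p k v) \<longleftrightarrow> k \<in> E)"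
    for p
  proof -
    \<comment> \<open>The list contains the values of all of the first \<open>K\<close> variables;
      at positions belonging to the other side of the partition it is not read.\<close>
    define pt where "pt e = map (\<lambda>n. case_sum e (\<lambda>b. b) (g n)) [0..<K]" for e
    have pt: "pt e \<in> tuples (carrier U) K" if "\<forall>v. e v \<in> carrier U" for e
    proof -
      have "case_sum e (\<lambda>b. b) (g n) \<in> carrier U" for n
        using that 1(2)[rule_format, of n] B_carrier by (cases "g n") auto
      then show ?thesis by (auto simp: tuples_def pt_def)
    qed
    have holds: "holds U (\<lambda>i. pt p ! i) (\<phi>', pt q) \<longleftrightarrow> R (\<lambda>v. if v \<in> W then q v else p v)" for p q
      unfolding holds_def prod.case \<phi>'(3) 1(3)
      by (rule sat_cong) (use K in \<open>auto simp: h_def pt_def split: sum.splits\<close>)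
    \<comment> \<open>VC-dimension counts elements of a set, so the points must be distinct. The
      singleton patterns separate them.\<close>
    have inj: "inj_on (\<lambda>k. pt (p k)) {..<Suc d}"
    proof (rule inj_onI)
      fix k k' assume k: "k \<in> {..<Suc d}" "k' \<in> {..<Suc d}" "pt (p k) = pt (p k')"
      obtain q where q: "\<forall>j<Suc d. R (\<lambda>v. if v \<in> W then q v else p j v) \<longleftrightarrow> j \<in> {k}"
        using E[rule_format, of "{k}"] k(1) by blast
      have "R (\<lambda>v. if v \<in> W then q v else p k' v) \<longleftrightarrow> R (\<lambda>v. if v \<in> W then q v else p k v)"
        unfolding holds[symmetric] k(3) ..
      with q k(1,2) show "k = k'" by simp
    qed
    define S where "S = (\<lambda>k. pt (p k)) ` {..<Suc d}"
    have "shatters {{a \<in> tuples (carrier U) K. holds U (\<lambda>i. a ! i) (\<phi>', b)} |b. b \<in> tuples (carrier U) K} S"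
      unfolding shatters_def
    proof (intro allI impI)
      fix S0 assume "S0 \<subseteq> S"
      define E0 where "E0 = {k\<in>{..<Suc d}. pt (p k) \<in> S0}"
      obtain q where q: "\<forall>v. q v \<in> carrier U" "\<forall>k<Suc d. R (\<lambda>v. if v \<in> W then q v else p k v) \<longleftrightarrow> k \<in> E0"
        using E[rule_format, of E0] unfolding E0_def by blast
      have "{a \<in> tuples (carrier U) K. holds U (\<lambda>i. a ! i) (\<phi>', pt q)} \<inter> S = S0"
      proof -
        have *: "pt (p k) \<in> {a \<in> tuples (carrier U) K. holds U (\<lambda>i. a ! i) (\<phi>', pt q)} \<longleftrightarrow> pt (p k) \<in> S0"
          if "k < Suc d" for k
          using that q(2) p pt[of "p k"] by (simp add: holds E0_def)
        show ?thesis
        proof (intro set_eqI iffI)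
          fix s assume "s \<in> {a \<in> tuples (carrier U) K. holds U (\<lambda>i. a ! i) (\<phi>', pt q)} \<inter> S"
          then show "s \<in> S0" using * by (auto simp only: S_def lessThan_iff)
        next
          fix s assume "s \<in> S0"
          moreover from this obtain k where "k < Suc d" "s = pt (p k)" using \<open>S0 \<subseteq> S\<close> by (auto simp: S_def)
          ultimately show "s \<in> {a \<in> tuples (carrier U) K. holds U (\<lambda>i. a ! i) (\<phi>', pt q)} \<inter> S"
            using *[of k] by (auto simp: S_def)
        qed
      qed
      then show "\<exists>X\<in>{{a \<in> tuples (carrier U) K. holds U (\<lambda>i. a ! i) (\<phi>', b)} |b. b \<in> tuples (carrier U) K}. X \<inter> S = S0"
        using pt[OF q(1)] by blast
    qed
    from d[OF this] show False
      using card_image[OF inj] by (simp add: S_def)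
  qed
  show ?thesis
  proof (intro exI[of _ "Suc d"] allI impI notI)
    fix p
    assume "\<forall>k<Suc d. \<forall>v. p k v \<in> carrier U"
      and "\<forall>E\<subseteq>{..<Suc d}. \<exists>q. (\<forall>v. q v \<in> carrier U) \<and> (\<forall>k<Suc d. R (\<lambda>v. if v \<in> W then q v else p k v) \<longleftrightarrow> k \<in> E)"
    then show False by (rule contra)
  qed
qed

end

section \<open>Definable predicates of the tuples x, z, y, d\<close>

definition vals :: "'b set \<Rightarrow> ('a \<Rightarrow> 'b) set" where
  "vals S = {f. \<forall>i. f i \<in> S}"

lemma vals_iff [simp]: "f \<in> vals S \<longleftrightarrow> (\<forall>i. f i \<in> S)"
  by (simp add: vals_def)

definition asg :: "('i \<Rightarrow> 'u) \<Rightarrow> (nat \<Rightarrow> 'u) \<Rightarrow> (nat \<Rightarrow> nat \<Rightarrow> 'u) \<Rightarrow> (nat \<Rightarrow> 'u) \<Rightarrow> 'i pvar \<Rightarrow> 'u" where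
  "asg x z y d v = (case v of XV i \<Rightarrow> x i | ZV j \<Rightarrow> z j | YV k j \<Rightarrow> y k j | DV j \<Rightarrow> d j)"

lemma asg_simps [simp]:
  "asg x z y d (XV i) = x i" "asg x z y d (ZV j) = z j" "asg x z y d (YV k j) = y k j"
  "asg x z y d (DV j) = d j"
  by (simp_all add: asg_def)

lemma asg_eta [simp]: "asg (\<lambda>i. e (XV i)) (\<lambda>j. e (ZV j)) (\<lambda>k j. e (YV k j)) (\<lambda>j. e (DV j)) = e"
  by (auto simp: fun_eq_iff asg_def split: pvar.splits)

context definability
begin

definition definable ::
  "(('i \<Rightarrow> 'u) \<Rightarrow> (nat \<Rightarrow> 'u) \<Rightarrow> (nat \<Rightarrow> nat \<Rightarrow> 'u) \<Rightarrow> (nat \<Rightarrow> 'u) \<Rightarrow> bool) \<Rightarrow> bool" where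
  "definable P \<longleftrightarrow> dfn (\<lambda>e. P (\<lambda>i. e (XV i)) (\<lambda>j. e (ZV j)) (\<lambda>k j. e (YV k j)) (\<lambda>j. e (DV j)))"

lemma definable_const: "definable (\<lambda>x z y d. b)"
  unfolding definable_def by (rule dfn_const)

lemma definable_neg: "definable P \<Longrightarrow> definable (\<lambda>x z y d. \<not> P x z y d)"
  unfolding definable_def by (rule dfn_neg)

lemma definable_conj:
  "definable P \<Longrightarrow> definable Q \<Longrightarrow> definable (\<lambda>x z y d. P x z y d \<and> Q x z y d)"
  unfolding definable_def by (rule dfn_conj)

lemma definable_imp:
  assumes "definable P" "definable Q"
  shows "definable (\<lambda>x z y d. P x z y d \<longrightarrow> Q x z y d)"
  using definable_neg[OF definable_conj[OF assms(1) definable_neg[OF assms(2)]]] by simp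

lemma definable_iff:
  assumes "definable P" "definable Q"
  shows "definable (\<lambda>x z y d. P x z y d \<longleftrightarrow> Q x z y d)"
  using definable_conj[OF definable_imp[OF assms] definable_imp[OF assms(2,1)]]
  by (simp add: iff_conv_conj_imp)

lemma definable_ball:
  assumes "finite S" "\<And>s. s \<in> S \<Longrightarrow> definable (P s)"
  shows "definable (\<lambda>x z y d. \<forall>s\<in>S. P s x z y d)"
  using assms
proof (induction S rule: finite_induct)
  case empty
  then show ?case by (simp add: definable_const)
next
  case (insert s S)
  then have "definable (\<lambda>x z y d. P s x z y d \<and> (\<forall>s\<in>S. P s x z y d))"
    by (intro definable_conj) auto
  then show ?case by simp
qed

lemma definable_bex:
  assumes "finite S" "\<And>s. s \<in> S \<Longrightarrow> definable (P s)"
  shows "definable (\<lambda>x z y d. \<exists>s\<in>S. P s x z y d)"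
  using definable_neg[OF definable_ball[OF assms(1) definable_neg[OF assms(2)]]] by simp

lemma definable_exX:
  assumes "definable P"
  shows "definable (\<lambda>x z y d. \<exists>x\<in>vals (carrier U). P x z y d)"
proof -
  \<comment> \<open>\<open>dfn_exW\<close> quantifies over a whole assignment; \<open>u0\<close>
    fills its entries outside the tuple \<open>x\<close>.\<close>
  obtain u0 where u0: "u0 \<in> carrier U" using carrier_ne by blast
  have "(\<exists>e' :: 'i pvar \<Rightarrow> 'u. (\<forall>v. e' v \<in> carrier U) \<and> P (\<lambda>i. e' (XV i)) z y d) \<longleftrightarrow> (\<exists>x\<in>vals (carrier U). P x z y d)" (is "?l \<longleftrightarrow> ?r") for z y d
  proof
    assume ?r
    then obtain x where "x \<in> vals (carrier U)" "P x z y d" by blast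
    then show ?l using u0
      by (intro exI[of _ "asg x (\<lambda>_. u0) (\<lambda>_ _. u0) (\<lambda>_. u0)"]) (auto simp: asg_def split: pvar.splits)
  qed auto
  with dfn_exW[OF assms[unfolded definable_def], of "range XV"] show ?thesis
    by (simp add: definable_def image_iff)
qed

lemma definable_exZ:
  assumes "definable P"
  shows "definable (\<lambda>x z y d. \<exists>z\<in>vals (carrier U). P x z y d)"
proof -
  obtain u0 where u0: "u0 \<in> carrier U" using carrier_ne by blast
  have "(\<exists>e' :: 'i pvar \<Rightarrow> 'u. (\<forall>v. e' v \<in> carrier U) \<and> P x (\<lambda>i. e' (ZV i)) y d) \<longleftrightarrow> (\<exists>z\<in>vals (carrier U). P x z y d)" (is "?l \<longleftrightarrow> ?r") for x y d
  proof
    assume ?r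
    then obtain z where "z \<in> vals (carrier U)" "P x z y d" by blast
    then show ?l using u0
      by (intro exI[of _ "asg (\<lambda>_. u0) z (\<lambda>_ _. u0) (\<lambda>_. u0)"]) (auto simp: asg_def split: pvar.splits)
  qed auto
  with dfn_exW[OF assms[unfolded definable_def], of "range ZV"] show ?thesis
    by (simp add: definable_def image_iff)
qed

lemma definable_exY:
  assumes "definable P"
  shows "definable (\<lambda>x z y d. \<exists>y\<in>vals (vals (carrier U)). P x z y d)"
proof -
  obtain u0 where u0: "u0 \<in> carrier U" using carrier_ne by blast
  have "(\<exists>e' :: 'i pvar \<Rightarrow> 'u. (\<forall>v. e' v \<in> carrier U) \<and> P x z (\<lambda>i j. e' (YV i j)) d) \<longleftrightarrow> (\<exists>y\<in>vals (vals (carrier U)). P x z y d)" (is "?l \<longleftrightarrow> ?r") for x z d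
  proof
    assume ?r
    then obtain y where "y \<in> vals (vals (carrier U))" "P x z y d" by blast
    then show ?l using u0
      by (intro exI[of _ "asg (\<lambda>_. u0) (\<lambda>_. u0) y (\<lambda>_. u0)"]) (auto simp: asg_def split: pvar.splits)
  qed auto
  with dfn_exW[OF assms[unfolded definable_def], of "{v. \<exists>i j. v = YV i j}"] show ?thesis
    by (simp add: definable_def)
qed

lemma definable_allX:
  "definable P \<Longrightarrow> definable (\<lambda>x z y d. \<forall>x\<in>vals (carrier U). P x z y d)"
  using definable_neg[OF definable_exX[OF definable_neg[of P]]] by simp

lemma definable_allY:
  "definable P \<Longrightarrow> definable (\<lambda>x z y d. \<forall>y\<in>vals (vals (carrier U)). P x z y d)"
  using definable_neg[OF definable_exY[OF definable_neg[of P]]] by simp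

text \<open>What may be substituted for an entry: another entry or a constant from \<open>B\<close>.
  Writing it as a function of all four tuples keeps assignments out of
  \<open>definable_subst\<close>.\<close>

definition pick ::
  "(('i \<Rightarrow> 'u) \<Rightarrow> (nat \<Rightarrow> 'u) \<Rightarrow> (nat \<Rightarrow> nat \<Rightarrow> 'u) \<Rightarrow> (nat \<Rightarrow> 'u) \<Rightarrow> 'u) \<Rightarrow> bool" where
  "pick p \<longleftrightarrow> (\<exists>k\<in>okvars. \<forall>x z y d. p x z y d = case_sum (asg x z y d) (\<lambda>b. b) k)"

lemma pick_simps [simp]:
  "pick (\<lambda>x z y d. z j)" "pick (\<lambda>x z y d. y k j)" "pick (\<lambda>x z y d. d j)"
  "b \<in> B \<Longrightarrow> pick (\<lambda>x z y d. b)"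
  unfolding pick_def
  by (rule bexI[of _ "Inl (ZV j)"] bexI[of _ "Inl (YV k j)"] bexI[of _ "Inl (DV j)"] bexI[of _ "Inr b"]; simp)+

lemma definable_subst:
  assumes "definable P" "\<And>j. pick (fz j)" "\<And>k j. pick (fy k j)" "\<And>j. pick (fd j)"
  shows "definable (\<lambda>x z y d. P x (\<lambda>j. fz j x z y d) (\<lambda>k j. fy k j x z y d) (\<lambda>j. fd j x z y d))"
proof -
  obtain kz where kz: "\<And>j. kz j \<in> okvars" "\<And>j x z y d. fz j x z y d = case_sum (asg x z y d) (\<lambda>b. b) (kz j)"
    using assms(2) unfolding pick_def by metis
  obtain ky where ky: "\<And>k j. ky k j \<in> okvars" "\<And>k j x z y d. fy k j x z y d = case_sum (asg x z y d) (\<lambda>b. b) (ky k j)"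
    using assms(3) unfolding pick_def by metis
  obtain kd where kd: "\<And>j. kd j \<in> okvars" "\<And>j x z y d. fd j x z y d = case_sum (asg x z y d) (\<lambda>b. b) (kd j)"
    using assms(4) unfolding pick_def by metis
  define h where "h v = (case v of XV i \<Rightarrow> Inl (XV i) | ZV j \<Rightarrow> kz j | YV k j \<Rightarrow> ky k j | DV j \<Rightarrow> kd j)" for v
  have "dfn (\<lambda>e. P (\<lambda>i. case_sum e (\<lambda>b. b) (h (XV i))) (\<lambda>j. case_sum e (\<lambda>b. b) (h (ZV j)))
      (\<lambda>k j. case_sum e (\<lambda>b. b) (h (YV k j))) (\<lambda>j. case_sum e (\<lambda>b. b) (h (DV j))))"
    by (rule dfn_subst[OF assms(1)[unfolded definable_def]]) (auto simp: h_def kz ky kd split: pvar.splits)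
  moreover have "P (\<lambda>i. e (XV i)) (\<lambda>j. fz j (\<lambda>i. e (XV i)) (\<lambda>j. e (ZV j)) (\<lambda>k j. e (YV k j)) (\<lambda>j. e (DV j)))
        (\<lambda>k j. fy k j (\<lambda>i. e (XV i)) (\<lambda>j. e (ZV j)) (\<lambda>k j. e (YV k j)) (\<lambda>j. e (DV j)))
        (\<lambda>j. fd j (\<lambda>i. e (XV i)) (\<lambda>j. e (ZV j)) (\<lambda>k j. e (YV k j)) (\<lambda>j. e (DV j))) \<longleftrightarrow>
      P (\<lambda>i. case_sum e (\<lambda>b. b) (h (XV i))) (\<lambda>j. case_sum e (\<lambda>b. b) (h (ZV j)))
      (\<lambda>k j. case_sum e (\<lambda>b. b) (h (YV k j))) (\<lambda>j. case_sum e (\<lambda>b. b) (h (DV j)))" for e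
    unfolding kz(2) ky(2) kd(2) asg_eta[of e] by (simp add: h_def)
  ultimately show ?thesis
    by (simp only: definable_def)
qed

text \<open>Two forms of NIP are used. Here the family is indexed by \<open>x\<close>, which serves
  for \<omega>; in the next lemma it is indexed by \<open>z\<close>, which serves for
  \<zeta>.\<close>

lemma definable_nip_x:
  assumes "NIP L U" and "definable (\<lambda>x z y d. P x y d)"
  shows "\<exists>N :: nat. \<forall>p q. (\<forall>k<N. p k \<in> vals (vals (carrier U)) \<and> q k \<in> vals (carrier U)) \<longrightarrow>
    \<not> (\<forall>E\<subseteq>{..<N}. \<exists>x\<in>vals (carrier U). \<forall>k<N. P x (p k) (q k) \<longleftrightarrow> k \<in> E)"
proof -
  obtain u0 where u0: "u0 \<in> carrier U" using carrier_ne by blast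
  have "\<exists>N. \<forall>p :: nat \<Rightarrow> 'i pvar \<Rightarrow> 'u. (\<forall>k<N. \<forall>v. p k v \<in> carrier U) \<longrightarrow>
    \<not> (\<forall>E\<subseteq>{..<N}. \<exists>q. (\<forall>v. q v \<in> carrier U) \<and> (\<forall>k<N.
        P (\<lambda>i. q (XV i)) (\<lambda>i j. p k (YV i j)) (\<lambda>j. p k (DV j)) \<longleftrightarrow> k \<in> E))"
    using dfn_nip[OF assms(1) assms(2)[unfolded definable_def], of "range XV"] by (simp add: image_iff)
  then obtain N where N: "\<And>p :: nat \<Rightarrow> 'i pvar \<Rightarrow> 'u. (\<forall>k<N. \<forall>v. p k v \<in> carrier U) \<Longrightarrow>
    \<not> (\<forall>E\<subseteq>{..<N}. \<exists>q. (\<forall>v. q v \<in> carrier U) \<and> (\<forall>k<N.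
        P (\<lambda>i. q (XV i)) (\<lambda>i j. p k (YV i j)) (\<lambda>j. p k (DV j)) \<longleftrightarrow> k \<in> E))"
    by blast
  show ?thesis
  proof (intro exI[of _ N] allI impI notI)
    fix p q
    assume pq: "\<forall>k<N. p k \<in> vals (vals (carrier U)) \<and> q k \<in> vals (carrier U)"
      and E: "\<forall>E\<subseteq>{..<N}. \<exists>x\<in>vals (carrier U). \<forall>k<N. P x (p k) (q k) \<longleftrightarrow> k \<in> E"
    let ?p = "\<lambda>k. asg (\<lambda>_. u0) (\<lambda>_. u0) (p k) (q k)"
    have "\<forall>k<N. \<forall>v. ?p k v \<in> carrier U"
      using pq u0 by (auto simp: asg_def split: pvar.splits)
    moreover have "\<exists>e :: 'i pvar \<Rightarrow> 'u. (\<forall>v. e v \<in> carrier U) \<and> (\<forall>k<N.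
        P (\<lambda>i. e (XV i)) (\<lambda>i j. ?p k (YV i j)) (\<lambda>j. ?p k (DV j)) \<longleftrightarrow> k \<in> E)" if sub: "E \<subseteq> {..<N}" for E
    proof -
      obtain x where x: "x \<in> vals (carrier U)" "\<forall>k<N. P x (p k) (q k) \<longleftrightarrow> k \<in> E"
        using E sub by blast
      then show ?thesis using u0
        by (intro exI[of _ "asg x (\<lambda>_. u0) (\<lambda>_ _. u0) (\<lambda>_. u0)"]) (auto simp: asg_def split: pvar.splits)
    qed
    ultimately show False using N[of ?p] by blast
  qed
qed

lemma definable_nip_z:
  assumes "NIP L U" and "definable (\<lambda>x z y d. P z (y 0))"
  shows "\<exists>N :: nat. \<forall>p. (\<forall>k<N. p k \<in> vals (carrier U)) \<longrightarrow>
    \<not> (\<forall>E\<subseteq>{..<N}. \<exists>z\<in>vals (carrier U). \<forall>k<N. P z (p k) \<longleftrightarrow> k \<in> E)"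
proof -
  obtain u0 where u0: "u0 \<in> carrier U" using carrier_ne by blast
  have "\<exists>N. \<forall>p :: nat \<Rightarrow> 'i pvar \<Rightarrow> 'u. (\<forall>k<N. \<forall>v. p k v \<in> carrier U) \<longrightarrow>
    \<not> (\<forall>E\<subseteq>{..<N}. \<exists>q :: 'i pvar \<Rightarrow> 'u. (\<forall>v. q v \<in> carrier U) \<and> (\<forall>k<N.
        P (\<lambda>i. q (ZV i)) (\<lambda>j. p k (YV 0 j)) \<longleftrightarrow> k \<in> E))"
    using dfn_nip[OF assms(1) assms(2)[unfolded definable_def], of "range ZV"] by (simp add: image_iff)
  then obtain N where N: "\<And>p :: nat \<Rightarrow> 'i pvar \<Rightarrow> 'u. (\<forall>k<N. \<forall>v. p k v \<in> carrier U) \<Longrightarrow>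
    \<not> (\<forall>E\<subseteq>{..<N}. \<exists>q :: 'i pvar \<Rightarrow> 'u. (\<forall>v. q v \<in> carrier U) \<and> (\<forall>k<N.
        P (\<lambda>i. q (ZV i)) (\<lambda>j. p k (YV 0 j)) \<longleftrightarrow> k \<in> E))"
    by blast
  show ?thesis
  proof (intro exI[of _ N] allI impI notI)
    fix p
    assume p: "\<forall>k<N. p k \<in> vals (carrier U)"
      and E: "\<forall>E\<subseteq>{..<N}. \<exists>z\<in>vals (carrier U). \<forall>k<N. P z (p k) \<longleftrightarrow> k \<in> E"
    let ?p = "\<lambda>k. asg (\<lambda>_. u0) (\<lambda>_. u0) (\<lambda>_. p k) (\<lambda>_. u0)"
    have "\<forall>k<N. \<forall>v. ?p k v \<in> carrier U"
      using p u0 by (auto simp: asg_def split: pvar.splits)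
    moreover have "\<exists>e :: 'i pvar \<Rightarrow> 'u. (\<forall>v. e v \<in> carrier U) \<and> (\<forall>k<N.
        P (\<lambda>i. e (ZV i)) (\<lambda>j. ?p k (YV 0 j)) \<longleftrightarrow> k \<in> E)" if sub: "E \<subseteq> {..<N}" for E
    proof -
      obtain z where z: "z \<in> vals (carrier U)" "\<forall>k<N. P z (p k) \<longleftrightarrow> k \<in> E"
        using E sub by blast
      then show ?thesis using u0
        by (intro exI[of _ "asg (\<lambda>_. u0) z (\<lambda>_ _. u0) (\<lambda>_. u0)"]) (auto simp: asg_def split: pvar.splits)
    qed
    ultimately show False using N[of ?p] by blast
  qed
qed

text \<open>There may be infinitely many \<open>b\<close>, but the predicate reads only the finitely
  many entries in its support, and each has finitely many values in \<open>A0\<close>.\<close>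

lemma finite_definable_instances:
  fixes m :: nat
  assumes "definable (\<lambda>x z y d. P x y d)" and "finite A0"
  shows "finite ((\<lambda>b x y d. P x (\<lambda>i. if i < m then b i else y i) d) ` vals (vals A0))"
proof -
  obtain S where S: "finite S" "\<And>e e'. (\<And>v. v \<in> S \<Longrightarrow> e v = e' v) \<Longrightarrow>
      P (\<lambda>i. e (XV i)) (\<lambda>i j. e (YV i j)) (\<lambda>j. e (DV j)) = P (\<lambda>i. e' (XV i)) (\<lambda>i j. e' (YV i j)) (\<lambda>j. e' (DV j))"
    using dfn_support[OF assms(1)[unfolded definable_def]] by blast
  define J where "J = {(i, j). YV i j \<in> S}"
  have "(\<lambda>(i, j). YV i j) ` J \<subseteq> S" "inj_on (\<lambda>(i, j). YV i j) J"
    by (auto simp: J_def inj_on_def)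
  then have "finite J" using S(1) by (meson finite_imageD finite_subset)
  let ?G = "\<lambda>r x y d. P x (\<lambda>i. if i < m then (\<lambda>j. r (i, j)) else y i) d"
  have "(\<lambda>x y d. P x (\<lambda>i. if i < m then b i else y i) d) \<in> ?G ` (J \<rightarrow>\<^sub>E A0)" if "b \<in> vals (vals A0)" for b
  proof (rule image_eqI)
    show "restrict (\<lambda>(i, j). b i j) J \<in> J \<rightarrow>\<^sub>E A0" using that by auto
    have "P x (\<lambda>i. if i < m then b i else y i) d =
        P x (\<lambda>i. if i < m then (\<lambda>j. restrict (\<lambda>(i, j). b i j) J (i, j)) else y i) d" (is "P x ?y1 d = P x ?y2 d") for x y d
    proof -
      have "asg x (\<lambda>_. undefined) ?y1 d v = asg x (\<lambda>_. undefined) ?y2 d v" if "v \<in> S" for v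
        using that by (cases v) (simp_all add: J_def)
      from S(2)[of "asg x (\<lambda>_. undefined) ?y1 d" "asg x (\<lambda>_. undefined) ?y2 d", OF this] show ?thesis by (simp only: asg_simps)
    qed
    then show "(\<lambda>x y d. P x (\<lambda>i. if i < m then b i else y i) d) =
        ?G (restrict (\<lambda>(i, j). b i j) J)" by blast
  qed
  then have "(\<lambda>b x y d. P x (\<lambda>i. if i < m then b i else y i) d) ` vals (vals A0) \<subseteq> ?G ` (J \<rightarrow>\<^sub>E A0)" by blast
  moreover have "finite (J \<rightarrow>\<^sub>E A0)" using \<open>finite J\<close> assms(2) by (simp add: finite_PiE)
  ultimately show ?thesis by (meson finite_imageI finite_subset)
qed

text \<open>Compressibility in \<open>L\<close> absorbs constants and parameters \<open>d\<close>
  from \<open>B\<close>: a formula contains finitely many of them, and these are added to the finite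
  set \<open>B0\<close>. The formula \<psi> does not depend on \<open>d\<close>.\<close>

lemma compressible_definable:
  assumes comp: "compressible L U I a B" and "B \<noteq> {}"
    and P: "definable (\<lambda>x z y d. P x y d)"
  shows "\<exists>\<psi>. definable (\<lambda>x z y d. \<psi> x z) \<and>
    (\<forall>B0\<subseteq>B. \<forall>d\<in>vals B. finite B0 \<longrightarrow> (\<exists>c\<in>vals B. \<psi> a c \<and>
      (\<forall>y\<in>vals (vals B0). P a y d \<longrightarrow> (\<forall>x\<in>vals (carrier U). \<psi> x c \<longrightarrow> P x y d))))"
proof -
  obtain b0 where b0: "b0 \<in> B" using assms(2) by blast
  obtain \<phi> :: "('f, 'r, nat) fm" and g where 1: "fm_in L \<phi>" "\<forall>n. g n \<in> okvars"
      "(\<lambda>e. P (\<lambda>i. e (XV i)) (\<lambda>k j. e (YV k j)) (\<lambda>j. e (DV j))) = (\<lambda>e. sat U (\<lambda>n. case_sum e (\<lambda>b. b) (g n)) \<phi>)"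
    using P unfolding definable_def dfn_def by blast
  have P_eq: "P x y d = sat U (\<lambda>n. case_sum (asg x (\<lambda>_. b0) y d) (\<lambda>b. b) (g n)) \<phi>" for x y d
    using fun_cong[OF 1(3), of "asg x (\<lambda>_. b0) y d"] by simp
  obtain K where K: "free_vars \<phi> \<subseteq> {..<K}"
    using finite_free_vars[of \<phi>] finite_nat_iff_bounded by blast
  \<comment> \<open>The entries of \<open>x\<close> stay on the left; rows, parameters and constants
    all join the finite parameter tuple on the right.\<close>
  define h :: "nat \<Rightarrow> 'i + nat" where
    "h n = (case g n of Inl (XV i) \<Rightarrow> Inl i | _ \<Rightarrow> Inr n)" for n
  have inf: "infinite (UNIV :: ('i + nat) set)" by (simp add: infinite_UNIV_nat)
  obtain \<phi>' :: "('f, 'r, 'i + nat) fm" where \<phi>': "fm_in L \<phi>'" "free_vars \<phi>' \<subseteq> h ` free_vars \<phi>"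
      "\<And>e. sat U e \<phi>' \<longleftrightarrow> sat U (\<lambda>n. e (h n)) \<phi>"
    using fm_rename_exists[OF inf 1(1), of h U] by blast
  have "h n \<in> Inl ` I \<union> Inr ` {..<K}" if "n \<in> free_vars \<phi>" for n
    using that K 1(2)[rule_format, of n] by (auto simp: h_def split: sum.splits pvar.splits)
  then have "part_fm L I K \<phi>'"
    using \<phi>'(1,2) unfolding part_fm_def by blast
  from comp[unfolded compressible_def, rule_format, OF this]
  obtain m \<psi> where \<psi>: "part_fm L I m \<psi>" and c: "\<forall>B0. finite B0 \<and> B0 \<subseteq> B \<longrightarrow>
      (\<exists>c\<in>tuples B m. holds U a (\<psi>, c) \<and> implies_in U I (\<psi>, c)
        ({(\<phi>', b) |b. b \<in> tuples B0 K \<and> holds U a (\<phi>', b)} \<union>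
         {(Neg \<phi>', b) |b. b \<in> tuples B0 K \<and> \<not> holds U a (\<phi>', b)}))"
    by (elim exE conjE) (rule that)
  define \<psi>' where "\<psi>' x z = sat U (case_sum x z) \<psi>" for x z
  have "dfn (\<lambda>e. sat U (\<lambda>v. case_sum e (\<lambda>b. b) (case_sum (\<lambda>i. Inl (XV i)) (\<lambda>j. Inl (ZV j)) v)) \<psi>)"
    by (rule dfn_formula) (use \<psi> in \<open>auto simp: part_fm_def\<close>)
  moreover have "(\<lambda>v. case_sum e (\<lambda>b. b) (case_sum (\<lambda>i. Inl (XV i)) (\<lambda>j. Inl (ZV j)) v)) =
      case_sum (\<lambda>i. e (XV i)) (\<lambda>j. e (ZV j))" for e :: "'i pvar \<Rightarrow> 'u"
    by (auto simp: fun_eq_iff split: sum.splits)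
  ultimately have def: "definable (\<lambda>x z y d. \<psi>' x z)"
    by (simp add: definable_def \<psi>'_def)
  have "\<exists>c\<in>vals B. \<psi>' a c \<and>
      (\<forall>y\<in>vals (vals B0). P a y d \<longrightarrow> (\<forall>x\<in>vals (carrier U). \<psi>' x c \<longrightarrow> P x y d))"
    if B0: "B0 \<subseteq> B" "finite B0" and d: "d \<in> vals B" for B0 d
  proof -
    \<comment> \<open>The value of each variable on the parameter side. With all rows equal to
      \<open>b0\<close> it yields exactly the values that do not come from \<open>y\<close>, which
      is what \<open>B1\<close> adds to \<open>B0\<close>.\<close>
    define kk where "kk y n = (case g n of Inl (YV i j) \<Rightarrow> y i j | Inl (DV j) \<Rightarrow> d j | Inr b \<Rightarrow> b | _ \<Rightarrow> b0)" for y n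
    define B1 where "B1 = B0 \<union> kk (\<lambda>_ _. b0) ` {..<K}"
    have "kk (\<lambda>_ _. b0) n \<in> B" for n
      using b0 d 1(2)[rule_format, of n] by (auto simp: kk_def split: sum.splits pvar.splits)
    then have "finite B1" "B1 \<subseteq> B" using B0 by (auto simp: B1_def)
    from c[rule_format, OF conjI[OF this]] obtain c where c': "c \<in> tuples B m" "holds U a (\<psi>, c)" "implies_in U I (\<psi>, c)
        ({(\<phi>', b) |b. b \<in> tuples B1 K \<and> holds U a (\<phi>', b)} \<union>
         {(Neg \<phi>', b) |b. b \<in> tuples B1 K \<and> \<not> holds U a (\<phi>', b)})"
      by (elim bexE conjE) (rule that)
    \<comment> \<open>The finite tuple \<open>c\<close> is padded to a sequence, as \<psi> reads
      only its first \<open>m\<close> entries.\<close>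
    define c1 where "c1 j = (if j < m then c ! j else b0)" for j
    have c1: "c1 \<in> vals B" using c'(1) b0 by (auto simp: c1_def tuples_def)
    have holds_c1: "holds U x (\<psi>, c) = \<psi>' x c1" for x
      unfolding holds_def prod.case \<psi>'_def
      by (rule sat_cong) (use \<psi> in \<open>auto simp: part_fm_def c1_def\<close>)
    have "P x y d" if y: "y \<in> vals (vals B0)" "P a y d" and x: "x \<in> vals (carrier U)" "\<psi>' x c1" for x y
    proof -
      define b where "b = map (kk y) [0..<K]"
      have "kk y n \<in> B1" if "n < K" for n
      proof -
        have "kk (\<lambda>_ _. b0) n \<in> B1" using that by (simp add: B1_def)
        moreover have "kk y n = kk (\<lambda>_ _. b0) n \<or> kk y n \<in> B0"
          using y(1) by (simp add: kk_def split: sum.splits pvar.splits)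
        ultimately show ?thesis by (auto simp: B1_def)
      qed
      then have b: "b \<in> tuples B1 K" by (auto simp: tuples_def b_def)
      have holds_b: "holds U x' (\<phi>', b) = P x' y d" for x'
        unfolding holds_def prod.case \<phi>'(3) P_eq
        by (rule sat_cong) (use K in \<open>auto simp: h_def b_def kk_def asg_def split: sum.splits pvar.splits\<close>)
      have "x \<in> I \<rightarrow> carrier U" "holds U x (\<psi>, c)" using x by (simp_all add: holds_c1)
      moreover have "(\<phi>', b) \<in> {(\<phi>', b) |b. b \<in> tuples B1 K \<and> holds U a (\<phi>', b)}"
        using b y(2) by (simp add: holds_b)
      ultimately have "holds U x (\<phi>', b)"
        using c'(3)[unfolded implies_in_def] by blast
      then show ?thesis by (simp add: holds_b)
    qed
    then show ?thesis using c1 c'(2) holds_c1 by blast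
  qed
  with def show ?thesis by blast
qed

lemma definable_of_part_fm:
  assumes "part_fm (lang_consts L B) I n \<phi>"
  shows "definable (\<lambda>x z y d. sat (struct_consts U) (case_sum x (y 0)) \<phi>)"
proof -
  have \<phi>: "fm_in (lang_consts L B) \<phi>" "free_vars \<phi> \<subseteq> Inl ` I \<union> Inr ` {..<n}"
    using assms by (auto simp: part_fm_def)
  let ?k = "case_sum (case_sum (\<lambda>i. Inl (XV i)) (\<lambda>j. Inl (YV 0 j))) Inr"
  have "?k ` free_vars (fm_unconst \<phi>) \<subseteq> okvars"
  proof
    fix v assume "v \<in> ?k ` free_vars (fm_unconst \<phi>)"
    then show "v \<in> okvars" using free_vars_unconst[OF \<phi>(1)] \<phi>(2) by fastforce
  qed
  then have "dfn (\<lambda>e. sat U (\<lambda>v. case_sum e (\<lambda>b. b) (?k v)) (fm_unconst \<phi>))"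
    by (rule dfn_formula[OF fm_in_unconst[OF \<phi>(1)]])
  moreover have "(\<lambda>v. case_sum e (\<lambda>b. b) (?k v)) =
      case_sum (case_sum (\<lambda>i. e (XV i)) (\<lambda>j. e (YV 0 j))) (\<lambda>b. b)" for e :: "'i pvar \<Rightarrow> 'u"
    by (auto simp: fun_eq_iff split: sum.splits)
  ultimately show ?thesis
    by (simp add: definable_def sat_unconst[OF \<phi>(1)])
qed

text \<open>The way back from predicates to formulas: constants from \<open>B\<close> become symbols
  of \<open>L(B)\<close>, while the finitely many entries of \<open>y\<close> and \<open>d\<close>
  that occur are collected in one tuple.\<close>

lemma part_fm_of_definable:
  assumes "definable (\<lambda>x z y d. P x y d)" and "s0 \<in> S"
  shows "\<exists>m \<chi>. part_fm (lang_consts L B) I m \<chi> \<and>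
    (\<forall>y\<in>vals (vals S). \<forall>d\<in>vals S. \<exists>c\<in>tuples S m. \<forall>x. holds (struct_consts U) x (\<chi>, c) \<longleftrightarrow> P x y d)"
proof -
  obtain \<phi> :: "('f, 'r, nat) fm" and g where 1: "fm_in L \<phi>" "\<forall>n. g n \<in> okvars"
      "(\<lambda>e. P (\<lambda>i. e (XV i)) (\<lambda>k j. e (YV k j)) (\<lambda>j. e (DV j))) = (\<lambda>e. sat U (\<lambda>n. case_sum e (\<lambda>b. b) (g n)) \<phi>)"
    using assms(1) unfolding definable_def dfn_def by blast
  have P_eq: "P x y d = sat U (\<lambda>n. case_sum (asg x (\<lambda>_. s0) y d) (\<lambda>b. b) (g n)) \<phi>" for x y d
    using fun_cong[OF 1(3), of "asg x (\<lambda>_. s0) y d"] by simp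
  obtain K where K: "free_vars \<phi> \<subseteq> {..<K}"
    using finite_free_vars[of \<phi>] finite_nat_iff_bounded by blast
  define \<sigma> :: "nat \<Rightarrow> ('f + 'u, 'i + nat) tm" where
    "\<sigma> n = (case g n of Inl (XV i) \<Rightarrow> Var (Inl i) | Inl _ \<Rightarrow> Var (Inr n) | Inr b \<Rightarrow> App (Inr b) [])" for n
  have inf: "infinite (UNIV :: ('i + nat) set)" by (simp add: infinite_UNIV_nat)
  have \<sigma>: "tm_in (lang_consts L B) (\<sigma> n)" for n
    using 1(2)[rule_format, of n] by (auto simp: \<sigma>_def split: sum.splits pvar.splits)
  have "\<exists>\<chi>. fm_in (lang_consts L B) \<chi> \<and> free_vars \<chi> \<subseteq> (\<Union>v\<in>free_vars \<phi>. tm_vars (\<sigma> v)) \<and>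
      (\<forall>e. sat (struct_consts U) e \<chi> \<longleftrightarrow> sat U (\<lambda>v. tm_val (struct_consts U) e (\<sigma> v)) \<phi>)"
    by (rule fm_subst_exists[where \<kappa>=Inl and L=L]) (use inf 1(1) \<sigma> in simp_all)
  then obtain \<chi> where \<chi>: "fm_in (lang_consts L B) \<chi>" "free_vars \<chi> \<subseteq> (\<Union>v\<in>free_vars \<phi>. tm_vars (\<sigma> v))"
      "\<And>e. sat (struct_consts U) e \<chi> \<longleftrightarrow> sat U (\<lambda>v. tm_val (struct_consts U) e (\<sigma> v)) \<phi>"
    by blast
  have "tm_vars (\<sigma> n) \<subseteq> Inl ` I \<union> Inr ` {..<K}" if "n \<in> free_vars \<phi>" for n
    using that K 1(2)[rule_format, of n] by (auto simp: \<sigma>_def split: sum.splits pvar.splits)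
  then have "part_fm (lang_consts L B) I K \<chi>"
    using \<chi>(1,2) unfolding part_fm_def by blast
  moreover have "\<exists>c\<in>tuples S K. \<forall>x. holds (struct_consts U) x (\<chi>, c) \<longleftrightarrow> P x y d"
    if "y \<in> vals (vals S)" "d \<in> vals S" for y d
  proof
    let ?k = "\<lambda>n. case g n of Inl (YV i j) \<Rightarrow> y i j | Inl (DV j) \<Rightarrow> d j | _ \<Rightarrow> s0"
    have "?k n \<in> S" for n
      using that assms(2) by (auto split: sum.splits pvar.splits)
    then show "map ?k [0..<K] \<in> tuples S K" by (auto simp: tuples_def)
    show "\<forall>x. holds (struct_consts U) x (\<chi>, map ?k [0..<K]) \<longleftrightarrow> P x y d"
    proof
      fix x
      show "holds (struct_consts U) x (\<chi>, map ?k [0..<K]) \<longleftrightarrow> P x y d"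
        unfolding holds_def prod.case \<chi>(3) P_eq
        by (rule sat_cong) (use K in \<open>auto simp: \<sigma>_def split: sum.splits pvar.splits\<close>)
    qed
  qed
  ultimately show ?thesis by blast
qed

end

section \<open>Undecided instances and shattering\<close>

declare vals_iff [simp del]

text \<open>One infinite sequence of parameters codes two, so that parameters can be added without keeping
  track of the number already in use.\<close>

definition ev :: "(nat \<Rightarrow> 'b) \<Rightarrow> nat \<Rightarrow> 'b" where
  "ev d = (\<lambda>j. d (2 * j))"

definition od :: "(nat \<Rightarrow> 'b) \<Rightarrow> nat \<Rightarrow> 'b" where
  "od d = (\<lambda>j. d (Suc (2 * j)))"

definition merge :: "(nat \<Rightarrow> 'b) \<Rightarrow> (nat \<Rightarrow> 'b) \<Rightarrow> nat \<Rightarrow> 'b" where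
  "merge d e = (\<lambda>n. if even n then d (n div 2) else e (n div 2))"

lemma ev_merge [simp]: "ev (merge d e) = d" and od_merge [simp]: "od (merge d e) = e"
  by (auto simp: ev_def od_def merge_def)

lemma merge_vals: "d \<in> vals S \<Longrightarrow> e \<in> vals S \<Longrightarrow> merge d e \<in> vals S"
  by (simp add: merge_def vals_iff)

text \<open>With \<open>dec_d\<close>, this lets one sequence code a pair of rows and parameters for
  each \<open>k\<close>. A formula with a single parameter sequence can thereby refer to any number
  of earlier points.\<close>

definition dec_y :: "nat \<Rightarrow> (nat \<Rightarrow> 'b) \<Rightarrow> nat \<Rightarrow> nat \<Rightarrow> 'b" where
  "dec_y k d = (\<lambda>i j. d (to_nat (k, Inl (i, j) :: nat \<times> nat + nat)))"

definition dec_d :: "nat \<Rightarrow> (nat \<Rightarrow> 'b) \<Rightarrow> nat \<Rightarrow> 'b" where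
  "dec_d k d = (\<lambda>j. d (to_nat (k, Inr j :: nat \<times> nat + nat)))"

lemma dec_exists:
  assumes "\<forall>k<n. p k \<in> vals (vals S) \<and> q k \<in> vals S" "s0 \<in> S"
  shows "\<exists>d\<in>vals S. \<forall>k<n. dec_y k d = p k \<and> dec_d k d = q k"
proof
  let ?d = "\<lambda>m. case from_nat m :: nat \<times> (nat \<times> nat + nat) of (k, s) \<Rightarrow>
    if k < n then case_sum (\<lambda>(i, j). p k i j) (q k) s else s0"
  show "?d \<in> vals S"
    using assms by (auto simp: vals_iff split: prod.splits sum.splits)
  show "\<forall>k<n. dec_y k ?d = p k \<and> dec_d k ?d = q k"
    by (simp add: dec_y_def dec_d_def)
qed

locale compressible_type = definability L U I B
  for L :: "('f, 'r) lang" and U :: "('f, 'r, 'u) struct" and I :: "'i set" and B :: "'u set" +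
  fixes A :: "'u set" and a :: "'i \<Rightarrow> 'u"
  assumes A_sub: "A \<subseteq> B" and A_ne: "A \<noteq> {}" and nip: "NIP L U"
    and comp: "compressible L U I a B" and a_vals: "a \<in> vals (carrier U)"
begin

text \<open>Only the instances true of \<open>a\<close> are compressed. The false ones are obtained
  by applying this to the negated formula.\<close>

definition one_sided :: "(('i \<Rightarrow> 'u) \<Rightarrow> (nat \<Rightarrow> 'u) \<Rightarrow> bool) \<Rightarrow> bool" where
  "one_sided \<phi> \<longleftrightarrow> (\<exists>\<chi>. definable (\<lambda>x z y d. \<chi> x y d) \<and>
     (\<forall>A0\<subseteq>A. finite A0 \<longrightarrow> (\<exists>y\<in>vals (vals A). \<exists>d\<in>vals A. \<chi> a y d \<and>
        (\<forall>b\<in>vals A0. \<phi> a b \<longrightarrow> (\<forall>x\<in>vals (carrier U). \<chi> x y d \<longrightarrow> \<phi> x b)))))"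

end

text \<open>The situation to be refuted. The number \<open>M\<close> of points to be shattered by
  \<zeta> is arbitrary.\<close>

locale not_one_sided = compressible_type L U I B A a
  for L :: "('f, 'r) lang" and U :: "('f, 'r, 'u) struct" and I :: "'i set" and B :: "'u set"
    and A :: "'u set" and a :: "'i \<Rightarrow> 'u" +
  fixes \<phi> :: "('i \<Rightarrow> 'u) \<Rightarrow> (nat \<Rightarrow> 'u) \<Rightarrow> bool" and \<psi> :: "('i \<Rightarrow> 'u) \<Rightarrow> (nat \<Rightarrow> 'u) \<Rightarrow> bool"
    and M :: nat and u0 :: 'u
  assumes \<phi>_def: "definable (\<lambda>x z y d. \<phi> x (y 0))" and not_one_sided: "\<not> one_sided \<phi>"
    and \<psi>_def: "definable (\<lambda>x z y d. \<psi> x z)"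
    and \<psi>: "\<And>B0. B0 \<subseteq> B \<Longrightarrow> finite B0 \<Longrightarrow> \<exists>c\<in>vals B. \<psi> a c \<and>
      (\<forall>b\<in>vals B0. \<phi> a b \<longrightarrow> (\<forall>x\<in>vals (carrier U). \<psi> x c \<longrightarrow> \<phi> x b))"
    and u0: "u0 \<in> A"
begin

definition \<zeta> :: "(nat \<Rightarrow> 'u) \<Rightarrow> (nat \<Rightarrow> 'u) \<Rightarrow> bool" where
  "\<zeta> z b \<longleftrightarrow> (\<forall>x\<in>vals (carrier U). \<psi> x z \<longrightarrow> \<phi> x b)"

definition formulas ::
  "(('i \<Rightarrow> 'u) \<Rightarrow> (nat \<Rightarrow> nat \<Rightarrow> 'u) \<Rightarrow> (nat \<Rightarrow> 'u) \<Rightarrow> bool) set \<Rightarrow> bool" where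
  "formulas \<Theta> \<longleftrightarrow> finite \<Theta> \<and> (\<forall>\<theta>\<in>\<Theta>. definable (\<lambda>x z y d. \<theta> x y d))"

text \<open>Overwriting the entry \<open>i\<close> by a constant makes \<open>\<theta>\<close> independent of \<open>b\<^sub>i\<close>, but not of the other
  entries.\<close>

definition undecided ::
  "(('i \<Rightarrow> 'u) \<Rightarrow> (nat \<Rightarrow> nat \<Rightarrow> 'u) \<Rightarrow> (nat \<Rightarrow> 'u) \<Rightarrow> bool) set \<Rightarrow> (nat \<Rightarrow> nat \<Rightarrow> 'u) \<Rightarrow> (nat \<Rightarrow> 'u) \<Rightarrow> nat \<Rightarrow> bool" where
  "undecided \<Theta> y d i \<longleftrightarrow> (\<exists>x\<in>vals (carrier U). \<not> \<phi> x (y i) \<and>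
     (\<forall>\<theta>\<in>\<Theta>. \<theta> a (y(i := \<lambda>_. u0)) d \<longrightarrow> \<theta> x (y(i := \<lambda>_. u0)) d))"

definition universal ::
  "(('i \<Rightarrow> 'u) \<Rightarrow> (nat \<Rightarrow> nat \<Rightarrow> 'u) \<Rightarrow> (nat \<Rightarrow> 'u) \<Rightarrow> bool) set \<Rightarrow> (nat \<Rightarrow> nat \<Rightarrow> 'u) set \<Rightarrow> bool" where
  "universal \<Theta> Q \<longleftrightarrow> (\<forall>d\<in>vals A. \<exists>y\<in>Q. \<forall>i<M. undecided \<Theta> y d i)"

text \<open>The finite set \<open>A0\<close> and the parameter \<open>c\<close> are fixed before \<open>d\<close> ranges over \<open>A\<close> in
  \<open>universal\<close>: this is what allows undecided tuples to be chosen over parameters that are found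
  later. The condition \<open>K\<close> on \<open>c\<close> is a formula, while \<open>J\<close> records arbitrary facts about the tuples.\<close>

definition config ::
  "(('i \<Rightarrow> 'u) \<Rightarrow> (nat \<Rightarrow> nat \<Rightarrow> 'u) \<Rightarrow> (nat \<Rightarrow> 'u) \<Rightarrow> bool) set \<Rightarrow> ((nat \<Rightarrow> 'u) \<Rightarrow> (nat \<Rightarrow> 'u) \<Rightarrow> bool) \<Rightarrow> ((nat \<Rightarrow> nat \<Rightarrow> 'u) \<Rightarrow> (nat \<Rightarrow> 'u) \<Rightarrow> bool) \<Rightarrow> 'u set \<Rightarrow> (nat \<Rightarrow> nat \<Rightarrow> 'u) set \<Rightarrow> (nat \<Rightarrow> 'u) \<Rightarrow> (nat \<Rightarrow> 'u) \<Rightarrow> bool" where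
  "config \<Theta> K J A0 Q c d \<longleftrightarrow> A0 \<subseteq> A \<and> finite A0 \<and> Q \<subseteq> vals (vals A0) \<and> universal \<Theta> Q \<and>
     c \<in> vals B \<and> d \<in> vals A \<and> \<psi> a c \<and> (\<forall>y\<in>Q. \<forall>i<M. \<zeta> c (y i)) \<and> K c d \<and> (\<forall>y\<in>Q. J y d)"

text \<open>Plays the part of consistency: the conditions can be met against every finite set of
  formulas. The chosen set, tuples and parameters may depend on \<Theta>.\<close>

definition valid :: "((nat \<Rightarrow> 'u) \<Rightarrow> (nat \<Rightarrow> 'u) \<Rightarrow> bool) \<Rightarrow> ((nat \<Rightarrow> nat \<Rightarrow> 'u) \<Rightarrow> (nat \<Rightarrow> 'u) \<Rightarrow> bool) \<Rightarrow> bool" where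
  "valid K J \<longleftrightarrow> (\<forall>\<Theta>. formulas \<Theta> \<longrightarrow> (\<exists>A0 Q c d. config \<Theta> K J A0 Q c d))"

section \<open>Finding tuples of mutually undecided instances\<close>

lemma u0_B: "u0 \<in> B" and A_carrier: "A \<subseteq> carrier U"
  using u0 A_sub B_carrier by auto

lemma vals_mono: "S \<subseteq> S' \<Longrightarrow> f \<in> vals S \<Longrightarrow> f \<in> vals S'"
  by (auto simp: vals_iff)

lemma not_one_sidedE:
  assumes "definable (\<lambda>x z y d. \<chi> x y d)"
  obtains A0 where "A0 \<subseteq> A" "finite A0"
    "\<And>y d. y \<in> vals (vals A) \<Longrightarrow> d \<in> vals A \<Longrightarrow> \<chi> a y d \<Longrightarrow>
      \<exists>b\<in>vals A0. \<phi> a b \<and> (\<exists>x\<in>vals (carrier U). \<chi> x y d \<and> \<not> \<phi> x b)"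
proof -
  have "\<not> (\<forall>A0\<subseteq>A. finite A0 \<longrightarrow> (\<exists>y\<in>vals (vals A). \<exists>d\<in>vals A. \<chi> a y d \<and>
        (\<forall>b\<in>vals A0. \<phi> a b \<longrightarrow> (\<forall>x\<in>vals (carrier U). \<chi> x y d \<longrightarrow> \<phi> x b))))"
    using not_one_sided assms unfolding one_sided_def by blast
  then obtain A0 where "A0 \<subseteq> A" "finite A0" and *: "\<not> (\<exists>y\<in>vals (vals A). \<exists>d\<in>vals A. \<chi> a y d \<and>
        (\<forall>b\<in>vals A0. \<phi> a b \<longrightarrow> (\<forall>x\<in>vals (carrier U). \<chi> x y d \<longrightarrow> \<phi> x b)))"
    by blast
  show ?thesis
    by (rule that[of A0]) (use \<open>A0 \<subseteq> A\<close> \<open>finite A0\<close> * in blast)+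
qed

text \<open>Which formulas of \<Theta> are true of \<open>a\<close> varies with \<open>y\<close> and
  \<open>d\<close>. For each subset of \<Theta> its conjunction fails to compress over some finite
  set; the union of these sets serves for all \<open>y\<close> and \<open>d\<close> at once.\<close>

lemma undecided_row:
  assumes "formulas \<Theta>"
  shows "\<exists>A0\<subseteq>A. finite A0 \<and> (\<forall>y\<in>vals (vals A). \<forall>d\<in>vals A. \<exists>b\<in>vals A0. \<phi> a b \<and>
    (\<exists>x\<in>vals (carrier U). \<not> \<phi> x b \<and> (\<forall>\<theta>\<in>\<Theta>. \<theta> a y d \<longrightarrow> \<theta> x y d)))"
proof -
  have "\<forall>s\<in>Pow \<Theta>. \<exists>A0. A0 \<subseteq> A \<and> finite A0 \<and> (\<forall>y\<in>vals (vals A). \<forall>d\<in>vals A. (\<forall>\<theta>\<in>s. \<theta> a y d) \<longrightarrow>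
      (\<exists>b\<in>vals A0. \<phi> a b \<and> (\<exists>x\<in>vals (carrier U). (\<forall>\<theta>\<in>s. \<theta> x y d) \<and> \<not> \<phi> x b)))"
  proof
    fix s assume s: "s \<in> Pow \<Theta>"
    then have "finite s" "\<And>\<theta>. \<theta> \<in> s \<Longrightarrow> definable (\<lambda>x z y d. \<theta> x y d)"
      using assms by (auto simp: formulas_def intro: finite_subset)
    then have "definable (\<lambda>x z y d. \<forall>\<theta>\<in>s. \<theta> x y d)" by (rule definable_ball)
    then obtain A0 where "A0 \<subseteq> A" "finite A0" "\<And>y d. y \<in> vals (vals A) \<Longrightarrow> d \<in> vals A \<Longrightarrow> \<forall>\<theta>\<in>s. \<theta> a y d \<Longrightarrow>
      \<exists>b\<in>vals A0. \<phi> a b \<and> (\<exists>x\<in>vals (carrier U). (\<forall>\<theta>\<in>s. \<theta> x y d) \<and> \<not> \<phi> x b)"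
      by (rule not_one_sidedE) (rule that)
    then show "\<exists>A0. A0 \<subseteq> A \<and> finite A0 \<and> (\<forall>y\<in>vals (vals A). \<forall>d\<in>vals A. (\<forall>\<theta>\<in>s. \<theta> a y d) \<longrightarrow>
      (\<exists>b\<in>vals A0. \<phi> a b \<and> (\<exists>x\<in>vals (carrier U). (\<forall>\<theta>\<in>s. \<theta> x y d) \<and> \<not> \<phi> x b)))"
      by (intro exI[of _ A0] conjI ballI impI)
  qed
  from bchoice[OF this] obtain F where F: "\<forall>s\<in>Pow \<Theta>. F s \<subseteq> A \<and> finite (F s) \<and>
      (\<forall>y\<in>vals (vals A). \<forall>d\<in>vals A. (\<forall>\<theta>\<in>s. \<theta> a y d) \<longrightarrow>
      (\<exists>b\<in>vals (F s). \<phi> a b \<and> (\<exists>x\<in>vals (carrier U). (\<forall>\<theta>\<in>s. \<theta> x y d) \<and> \<not> \<phi> x b)))" ..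
  let ?A0 = "\<Union>s\<in>Pow \<Theta>. F s"
  have "?A0 \<subseteq> A" using F by blast
  moreover have "finite ?A0" using F assms by (simp add: formulas_def)
  moreover have "\<exists>b\<in>vals ?A0. \<phi> a b \<and>
      (\<exists>x\<in>vals (carrier U). \<not> \<phi> x b \<and> (\<forall>\<theta>\<in>\<Theta>. \<theta> a y d \<longrightarrow> \<theta> x y d))"
    if yd: "y \<in> vals (vals A)" "d \<in> vals A" for y d
  proof -
    define s where "s = {\<theta>\<in>\<Theta>. \<theta> a y d}"
    have s: "s \<in> Pow \<Theta>" "\<forall>\<theta>\<in>s. \<theta> a y d" by (auto simp: s_def)
    have "\<exists>b\<in>vals (F s). \<phi> a b \<and> (\<exists>x\<in>vals (carrier U). (\<forall>\<theta>\<in>s. \<theta> x y d) \<and> \<not> \<phi> x b)"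
      using F[rule_format, OF s(1)] yd s(2) by blast
    then obtain b x where b: "b \<in> vals (F s)" "\<phi> a b" "x \<in> vals (carrier U)" "\<forall>\<theta>\<in>s. \<theta> x y d" "\<not> \<phi> x b"
      by blast
    have "b \<in> vals ?A0"
      by (rule vals_mono[OF _ b(1)]) (use s(1) in blast)
    with b show ?thesis unfolding s_def by blast
  qed
  ultimately show ?thesis by (intro exI[of _ ?A0] conjI ballI)
qed

text \<open>Each row must be undecided over earlier and later ones alike. The induction hypothesis
  fixes a finite set in which the first \<open>m\<close> rows will lie. Row \<open>m\<close> is
  chosen against all their possible values there, and only then are the first rows chosen over
  it.\<close>

lemma undecided_rows:
  assumes "formulas \<Theta>"
  shows "\<exists>A0\<subseteq>A. finite A0 \<and> (\<forall>y0\<in>vals (vals A). \<forall>d\<in>vals A. \<exists>y. (\<forall>i\<ge>m. y i = y0 i) \<and>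
    (\<forall>i<m. y i \<in> vals A0 \<and> \<phi> a (y i) \<and> undecided \<Theta> y d i))"
proof (induction m)
  case 0
  show ?case by (intro exI[of _ "{}"]) auto
next
  case (Suc m)
  then obtain A1 where A1: "A1 \<subseteq> A" "finite A1" and IH: "\<And>y0 d. y0 \<in> vals (vals A) \<Longrightarrow> d \<in> vals A \<Longrightarrow>
      \<exists>y. (\<forall>i\<ge>m. y i = y0 i) \<and> (\<forall>i<m. y i \<in> vals A1 \<and> \<phi> a (y i) \<and> undecided \<Theta> y d i)"
    by blast
  \<comment> \<open>\<open>u0\<close> is added so that the padding rows of \<open>b'\<close> below
    also have their entries in this set.\<close>
  define A1' where "A1' = insert u0 A1"
  have A1': "A1' \<subseteq> A" "finite A1'" using A1 u0 by (auto simp: A1'_def)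
  define P where "P \<theta> b x y d = \<theta> x ((\<lambda>i. if i < m then b i else y i)(m := \<lambda>_. u0)) d"
    for \<theta> :: "('i \<Rightarrow> 'u) \<Rightarrow> (nat \<Rightarrow> nat \<Rightarrow> 'u) \<Rightarrow> (nat \<Rightarrow> 'u) \<Rightarrow> bool" and b x y d
  \<comment> \<open>All instances with the first \<open>m\<close> rows taken from
    \<open>A1'\<close>; finite, because each formula reads only finitely many entries.\<close>
  define \<Theta>' where "\<Theta>' = (\<Union>\<theta>\<in>\<Theta>. P \<theta> ` vals (vals A1'))"
  have P_def': "P \<theta> = (\<lambda>b x y d. (\<lambda>x y d. \<theta> x (y(m := \<lambda>_. u0)) d) x (\<lambda>i. if i < m then b i else y i) d)" for \<theta>
    by (simp add: P_def fun_eq_iff)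
  have def1: "definable (\<lambda>x z y d. \<theta> x (y(m := \<lambda>_. u0)) d)" if "\<theta> \<in> \<Theta>" for \<theta>
  proof -
    have "definable (\<lambda>x z y d. \<theta> x (\<lambda>k j. (\<lambda>x z y d. if k = m then u0 else y k j) x z y d) (\<lambda>j. (\<lambda>x z y d. d j) x z y d))"
    proof (rule definable_subst[where P="\<lambda>x z y d. \<theta> x y d" and fz="\<lambda>j x z y d. z j"])
      show "definable (\<lambda>x z y d. \<theta> x y d)" using assms that by (simp add: formulas_def)
      show "pick (\<lambda>x z y d. if k = m then u0 else y k j)" for k j
        by (cases "k = m") (simp_all add: u0_B)
    qed simp_all
    moreover have "(\<lambda>k j. if k = m then u0 else y k j) = y(m := \<lambda>_. u0)" for y :: "nat \<Rightarrow> nat \<Rightarrow> 'u"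
      by (auto simp: fun_eq_iff)
    ultimately show ?thesis by simp
  qed
  have "formulas \<Theta>'"
    unfolding formulas_def
  proof
    have "finite (P \<theta> ` vals (vals A1'))" if "\<theta> \<in> \<Theta>" for \<theta>
      unfolding P_def' by (rule finite_definable_instances[OF def1[OF that] A1'(2)])
    then show "finite \<Theta>'" using assms by (auto simp: \<Theta>'_def formulas_def)
    have "definable (\<lambda>x z y d. P \<theta> b x y d)" if \<theta>: "\<theta> \<in> \<Theta>" and b: "b \<in> vals (vals A1')" for \<theta> b
    proof -
      have "definable (\<lambda>x z y d. (\<lambda>x y d. \<theta> x (y(m := \<lambda>_. u0)) d) x
          (\<lambda>k j. (\<lambda>x z y d. if k < m then b k j else y k j) x z y d) (\<lambda>j. (\<lambda>x z y d. d j) x z y d))"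
      proof (rule definable_subst[where P="\<lambda>x z y d. (\<lambda>x y d. \<theta> x (y(m := \<lambda>_. u0)) d) x y d" and fz="\<lambda>j x z y d. z j"])
        show "definable (\<lambda>x z y d. (\<lambda>x y d. \<theta> x (y(m := \<lambda>_. u0)) d) x y d)" by (rule def1[OF \<theta>])
        show "pick (\<lambda>x z y d. if k < m then b k j else y k j)" for k j
          using b A1'(1) A_sub by (cases "k < m") (auto simp: vals_iff intro!: pick_simps(4))
      qed simp_all
      moreover have "(\<lambda>k j. if k < m then b k j else y k j) = (\<lambda>i. if i < m then b i else y i)" for y :: "nat \<Rightarrow> nat \<Rightarrow> 'u"
        by (auto simp: fun_eq_iff)
      ultimately show ?thesis by (simp add: P_def)
    qed
    then show "\<forall>\<theta>\<in>\<Theta>'. definable (\<lambda>x z y d. \<theta> x y d)" by (auto simp: \<Theta>'_def)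
  qed
  from undecided_row[OF this] obtain A2 where "A2 \<subseteq> A \<and> finite A2 \<and> (\<forall>y\<in>vals (vals A). \<forall>d\<in>vals A. \<exists>b\<in>vals A2. \<phi> a b \<and>
      (\<exists>x\<in>vals (carrier U). \<not> \<phi> x b \<and> (\<forall>\<theta>\<in>\<Theta>'. \<theta> a y d \<longrightarrow> \<theta> x y d)))" ..
  then have A2: "A2 \<subseteq> A" "finite A2" and row: "\<And>y d. y \<in> vals (vals A) \<Longrightarrow> d \<in> vals A \<Longrightarrow>
      \<exists>b\<in>vals A2. \<phi> a b \<and> (\<exists>x\<in>vals (carrier U). \<not> \<phi> x b \<and> (\<forall>\<theta>\<in>\<Theta>'. \<theta> a y d \<longrightarrow> \<theta> x y d))"
    by simp_all
  have "\<exists>y. (\<forall>i\<ge>Suc m. y i = y0 i) \<and>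
      (\<forall>i<Suc m. y i \<in> vals (A1' \<union> A2) \<and> \<phi> a (y i) \<and> undecided \<Theta> y d i)"
    if y0: "y0 \<in> vals (vals A)" and d: "d \<in> vals A" for y0 :: "nat \<Rightarrow> nat \<Rightarrow> 'u" and d :: "nat \<Rightarrow> 'u"
  proof -
    obtain b x where b: "b \<in> vals A2" "\<phi> a b" "x \<in> vals (carrier U)" "\<not> \<phi> x b"
        "\<forall>\<theta>\<in>\<Theta>'. \<theta> a y0 d \<longrightarrow> \<theta> x y0 d"
      using row[OF y0 d] by blast
    \<comment> \<open>With \<open>b\<close> in place at \<open>m\<close>, the induction hypothesis
      supplies the first rows, undecided over \<open>b\<close> as well.\<close>
    have "y0(m := b) \<in> vals (vals A)" using y0 b(1) A2(1) by (auto simp: vals_iff)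
    from IH[OF this d] obtain y where y: "\<forall>i\<ge>m. y i = (y0(m := b)) i"
        "\<forall>i<m. y i \<in> vals A1 \<and> \<phi> a (y i) \<and> undecided \<Theta> y d i" by blast
    have ym: "y m = b" using y(1) by simp
    \<comment> \<open>Names the instance in \<Theta>' that belongs to the rows actually found,
      against which \<open>b\<close> was already chosen.\<close>
    define b' where "b' i = (if i < m then y i else (\<lambda>_. u0))" for i
    have b': "b' \<in> vals (vals A1')" using y(2) by (auto simp: vals_iff b'_def A1'_def)
    have "(\<lambda>i. if i < m then b' i else y0 i)(m := \<lambda>_. u0) = y(m := \<lambda>_. u0)"
      using y(1) by (auto simp: fun_eq_iff b'_def)
    then have P: "P \<theta> b' x' y0 d = \<theta> x' (y(m := \<lambda>_. u0)) d" for \<theta> x'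
      by (simp add: P_def)
    have "undecided \<Theta> y d m"
      unfolding undecided_def ym
    proof (intro bexI[OF _ b(3)] conjI b(4) ballI impI)
      fix \<theta> assume \<theta>: "\<theta> \<in> \<Theta>" "\<theta> a (y(m := \<lambda>_. u0)) d"
      have "P \<theta> b' \<in> \<Theta>'" using \<theta>(1) b' by (auto simp: \<Theta>'_def)
      with b(5) have "P \<theta> b' a y0 d \<longrightarrow> P \<theta> b' x y0 d" by blast
      then show "\<theta> x (y(m := \<lambda>_. u0)) d" using \<theta>(2) by (simp only: P simp_thms)
    qed
    then have "\<forall>i<Suc m. y i \<in> vals (A1' \<union> A2) \<and> \<phi> a (y i) \<and> undecided \<Theta> y d i"
      using y(2) ym b(1,2) by (auto simp: less_Suc_eq A1'_def vals_iff)
    moreover have "\<forall>i\<ge>Suc m. y i = y0 i" using y(1) by simp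
    ultimately show ?thesis by blast
  qed
  note rows = this
  show ?case
  proof (intro exI[of _ "A1' \<union> A2"] conjI ballI)
    show "A1' \<union> A2 \<subseteq> A" "finite (A1' \<union> A2)" using A1' A2 by simp_all
  qed (rule rows)
qed

text \<open>The finite set from \<open>undecided_rows\<close> serves for every \<open>d\<close>, so
  a single \<open>c\<close> compressing the true instances over it can be fixed in advance.
  \<open>Q\<close> consists of all tuples of true instances from that set.\<close>

lemma valid_init: "valid (\<lambda>_ _. True) (\<lambda>_ _. True)"
  unfolding valid_def
proof (intro allI impI)
  fix \<Theta> assume "formulas \<Theta>"
  from undecided_rows[OF this, of M] obtain A1 where A1: "A1 \<subseteq> A" "finite A1" and
    rows: "\<And>y0 d. y0 \<in> vals (vals A) \<Longrightarrow> d \<in> vals A \<Longrightarrow> \<exists>y. (\<forall>i\<ge>M. y i = y0 i) \<and>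
      (\<forall>i<M. y i \<in> vals A1 \<and> \<phi> a (y i) \<and> undecided \<Theta> y d i)" by blast
  define A0 where "A0 = insert u0 A1"
  have A0: "A0 \<subseteq> A" "finite A0" "A0 \<subseteq> B" using A1 u0 A_sub by (auto simp: A0_def)
  define Q where "Q = {y \<in> vals (vals A0). \<forall>i<M. \<phi> a (y i)}"
  have "universal \<Theta> Q"
    unfolding universal_def
  proof
    fix d :: "nat \<Rightarrow> 'u" assume d: "d \<in> vals A"
    have "(\<lambda>_ _. u0) \<in> (vals (vals A) :: (nat \<Rightarrow> nat \<Rightarrow> 'u) set)" using u0 by (simp add: vals_iff)
    from rows[OF this d] obtain y where y: "\<forall>i\<ge>M. y i = (\<lambda>_. u0)"
        "\<forall>i<M. y i \<in> vals A1 \<and> \<phi> a (y i) \<and> undecided \<Theta> y d i" by blast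
    have "y i \<in> vals A0" for i
      using y by (cases "i < M") (auto simp: A0_def vals_iff)
    then have "y \<in> Q" using y(2) by (simp add: Q_def vals_iff[of y])
    then show "\<exists>y\<in>Q. \<forall>i<M. undecided \<Theta> y d i" using y(2) by blast
  qed
  moreover obtain c where c: "c \<in> vals B" "\<psi> a c" "\<forall>b\<in>vals A0. \<phi> a b \<longrightarrow> (\<forall>x\<in>vals (carrier U). \<psi> x c \<longrightarrow> \<phi> x b)"
    using \<psi>[OF A0(3,2)] by blast
  moreover have "\<forall>y\<in>Q. \<forall>i<M. \<zeta> c (y i)"
    using c(3) by (simp add: Q_def \<zeta>_def vals_iff[where S="vals A0"])
  ultimately have "config \<Theta> (\<lambda>_ _. True) (\<lambda>_ _. True) A0 Q c (\<lambda>_. u0)"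
    using A0 u0 by (simp add: config_def vals_iff[of "\<lambda>_. u0"]) (simp add: Q_def)
  then show "\<exists>A0 Q c d. config \<Theta> (\<lambda>_ _. True) (\<lambda>_ _. True) A0 Q c d" by blast
qed

section \<open>Refining valid conditions\<close>

lemma valid_ev:
  assumes "valid K J"
  shows "valid (\<lambda>z d. K z (ev d)) (\<lambda>y d. J y (ev d))"
  unfolding valid_def
proof (intro allI impI)
  fix \<Theta> assume "formulas \<Theta>"
  then obtain A0 Q c d where "config \<Theta> K J A0 Q c d" using assms unfolding valid_def by blast
  then have "config \<Theta> (\<lambda>z d. K z (ev d)) (\<lambda>y d. J y (ev d)) A0 Q c (merge d d)"
    unfolding config_def using merge_vals[of d A d] by auto
  then show "\<exists>A0 Q c d. config \<Theta> (\<lambda>z d. K z (ev d)) (\<lambda>y d. J y (ev d)) A0 Q c d" by blast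
qed

lemma definable_param:
  assumes "definable (\<lambda>x z y d. \<theta> x y d)" "f = ev \<or> f = od"
  shows "definable (\<lambda>x z y d. \<theta> x y (f d))"
proof -
  have "ev = (\<lambda>(d :: nat \<Rightarrow> 'u) j. d (2 * j))" "od = (\<lambda>(d :: nat \<Rightarrow> 'u) j. d (Suc (2 * j)))"
    by (simp_all add: ev_def od_def fun_eq_iff)
  with assms(2) obtain r where r: "f = (\<lambda>d j. d (r j))" by metis
  have "definable (\<lambda>x z y d. \<theta> x (\<lambda>k j. (\<lambda>x z y d. y k j) x z y d) (\<lambda>j. (\<lambda>x z y d. d (r j)) x z y d))"
    by (rule definable_subst[where P="\<lambda>x z y d. \<theta> x y d" and fz="\<lambda>j x z y d. z j"]) (simp_all add: assms)
  then show ?thesis by (simp add: r)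
qed

text \<open>A partition argument, for arbitrary \<open>P\<close>. If the tuples failing
  \<open>P\<close> are not universal for \<Theta>0, some \<open>d0\<close> witnesses this; pairing
  every \<open>d1\<close> with \<open>d0\<close> forces the undecided tuples to satisfy
  \<open>P\<close>.\<close>

lemma valid_split:
  assumes "valid K J"
  shows "valid K (\<lambda>y d. J y d \<and> P y d) \<or> valid K (\<lambda>y d. J y d \<and> \<not> P y d)"
proof (rule disjCI)
  assume "\<not> valid K (\<lambda>y d. J y d \<and> \<not> P y d)"
  then obtain \<Theta>0 where \<Theta>0: "formulas \<Theta>0" "\<And>A0 Q c d. \<not> config \<Theta>0 K (\<lambda>y d. J y d \<and> \<not> P y d) A0 Q c d"
    unfolding valid_def by blast
  show "valid K (\<lambda>y d. J y d \<and> P y d)"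
    unfolding valid_def
  proof (intro allI impI)
    fix \<Theta> assume \<Theta>: "formulas \<Theta>"
    \<comment> \<open>One parameter sequence carries those of both sets: the even half for \<Theta>,
      the odd half for \<Theta>0.\<close>
    define \<Theta>' where "\<Theta>' = (\<lambda>\<theta> x y d. \<theta> x y (ev d)) ` \<Theta> \<union> (\<lambda>\<theta> x y d. \<theta> x y (od d)) ` \<Theta>0"
    have "formulas \<Theta>'"
      using \<Theta> \<Theta>0(1) by (auto simp: formulas_def \<Theta>'_def intro: definable_param)
    then obtain A0 Q c d where cfg: "config \<Theta>' K J A0 Q c d"
      using assms unfolding valid_def by blast
    define Q1 where "Q1 = {y\<in>Q. \<not> P y d}"
    have "\<not> config \<Theta>0 K (\<lambda>y d. J y d \<and> \<not> P y d) A0 Q1 c d" by (rule \<Theta>0)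
    then have "\<not> universal \<Theta>0 Q1" using cfg by (auto simp: config_def Q1_def)
    \<comment> \<open>All conditions of a configuration other than universality pass to the subset
      \<open>Q1\<close>, so universality must be what fails.\<close>
    then obtain d0 where d0: "d0 \<in> vals A" "\<And>y. y \<in> Q1 \<Longrightarrow> \<not> (\<forall>i<M. undecided \<Theta>0 y d0 i)"
      unfolding universal_def by blast
    have "universal \<Theta> (Q - Q1)"
      unfolding universal_def
    proof
      fix d1 :: "nat \<Rightarrow> 'u" assume d1: "d1 \<in> vals A"
      have "universal \<Theta>' Q" using cfg by (simp add: config_def)
      then obtain y where y: "y \<in> Q" "\<forall>i<M. undecided \<Theta>' y (merge d1 d0) i"
        using merge_vals[OF d1 d0(1)] unfolding universal_def by blast
      have *: "undecided \<Theta> y d1 i \<and> undecided \<Theta>0 y d0 i" if "undecided \<Theta>' y (merge d1 d0) i" for i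
      proof -
        from that obtain x where x: "x \<in> vals (carrier U)" "\<not> \<phi> x (y i)"
            "\<forall>\<theta>\<in>\<Theta>'. \<theta> a (y(i := \<lambda>_. u0)) (merge d1 d0) \<longrightarrow> \<theta> x (y(i := \<lambda>_. u0)) (merge d1 d0)"
          unfolding undecided_def by blast
        from x(3) have "(\<forall>\<theta>\<in>\<Theta>. \<theta> a (y(i := \<lambda>_. u0)) d1 \<longrightarrow> \<theta> x (y(i := \<lambda>_. u0)) d1) \<and>
            (\<forall>\<theta>\<in>\<Theta>0. \<theta> a (y(i := \<lambda>_. u0)) d0 \<longrightarrow> \<theta> x (y(i := \<lambda>_. u0)) d0)"
          unfolding \<Theta>'_def ball_Un ball_simps ev_merge od_merge .
        with x(1,2) show ?thesis unfolding undecided_def by blast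
      qed
      then have "y \<notin> Q1" using d0(2) y(2) by blast
      then show "\<exists>y\<in>Q - Q1. \<forall>i<M. undecided \<Theta> y d1 i" using y * by blast
    qed
    then have "config \<Theta> K (\<lambda>y d. J y d \<and> P y d) A0 (Q - Q1) c d"
      using cfg by (auto simp: config_def Q1_def)
    then show "\<exists>A0 Q c d. config \<Theta> K (\<lambda>y d. J y d \<and> P y d) A0 Q c d" by blast
  qed
qed

lemma valid_mono:
  assumes "valid K J" "\<And>y d. y \<in> vals (vals A) \<Longrightarrow> J y d \<Longrightarrow> J' y d"
  shows "valid K J'"
  unfolding valid_def
proof (intro allI impI)
  fix \<Theta> assume "formulas \<Theta>"
  then obtain A0 Q c d where cfg: "config \<Theta> K J A0 Q c d" using assms(1) unfolding valid_def by blast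
  have "y \<in> vals (vals A)" if "y \<in> Q" for y
  proof -
    have "y \<in> vals (vals A0)" "A0 \<subseteq> A" using cfg that by (auto simp: config_def)
    then show ?thesis by (auto simp: vals_iff)
  qed
  then have "config \<Theta> K J' A0 Q c d"
    using cfg assms(2) by (simp add: config_def)
  then show "\<exists>A0 Q c d. config \<Theta> K J' A0 Q c d" by blast
qed

section \<open>Isolation and one step of strengthening\<close>

lemma definable_dec:
  assumes "definable (\<lambda>x z y d. \<omega> x y d)"
  shows "definable (\<lambda>x z y d. \<omega> x (dec_y k (od d)) (dec_d k (od d)))"
proof -
  have "definable (\<lambda>x z y d. \<omega> x (\<lambda>i j. (\<lambda>x z y d. d (Suc (2 * to_nat (k, Inl (i, j) :: nat \<times> nat + nat)))) x z y d)
      (\<lambda>j. (\<lambda>x z y d. d (Suc (2 * to_nat (k, Inr j :: nat \<times> nat + nat)))) x z y d))"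
    by (rule definable_subst[where P="\<lambda>x z y d. \<omega> x y d" and fz="\<lambda>j x z y d. z j"]) (simp_all add: assms)
  then show ?thesis by (simp add: dec_y_def dec_d_def od_def)
qed

lemma definable_inst_z:
  assumes "definable (\<lambda>x z y d. \<psi>' x z)" "c \<in> vals B"
  shows "definable (\<lambda>x z y d. \<psi>' x c)"
proof -
  have "definable (\<lambda>x z y d. \<psi>' x (\<lambda>j. (\<lambda>x z y d. c j) x z y d))"
    by (rule definable_subst[where P="\<lambda>x z y d. \<psi>' x z" and fy="\<lambda>k j x z y d. y k j" and fd="\<lambda>j x z y d. d j"])
      (use assms in \<open>simp_all add: vals_iff\<close>)
  then show ?thesis by simp
qed

text \<open>The strengthening of the condition on \<open>z\<close>: \<open>\<psi>(x, z)\<close> does not imply \<open>\<omega>(x, y)\<close> for any \<open>y\<close>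
  satisfying \<open>\<Lambda>\<close>. Here \<open>\<omega>\<close> uses only the even half of the parameters.\<close>

definition non_isolating ::
  "(('i \<Rightarrow> 'u) \<Rightarrow> (nat \<Rightarrow> nat \<Rightarrow> 'u) \<Rightarrow> (nat \<Rightarrow> 'u) \<Rightarrow> bool) \<Rightarrow> ((nat \<Rightarrow> nat \<Rightarrow> 'u) \<Rightarrow> (nat \<Rightarrow> 'u) \<Rightarrow> bool) \<Rightarrow>
    (nat \<Rightarrow> 'u) \<Rightarrow> (nat \<Rightarrow> 'u) \<Rightarrow> bool" where
  "non_isolating \<omega> \<Lambda> z d \<longleftrightarrow> (\<forall>y\<in>vals (vals (carrier U)). \<Lambda> y d \<longrightarrow>
     (\<exists>x\<in>vals (carrier U). \<psi> x z \<and> \<not> \<omega> x y (ev d)))"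

text \<open>The parameter \<open>c\<close> and the finite set containing the last point are chosen first, then the other
  points inside \<open>\<psi>(x, c) \<and> \<psi>'(x, e)\<close>, and the last point itself at the end. If it is to satisfy
  \<open>\<omega>\<close>, then \<open>\<psi>(x, c)\<close> helps, which implies \<open>\<omega>\<close> at a point indistinguishable by \<open>\<Lambda>\<close>; otherwise
  \<open>\<psi>'(x, e)\<close> does, which implies the negation of \<open>\<omega>\<close> on the whole finite set.\<close>

lemma shatter_of_isolating:
  fixes n :: nat
  assumes \<omega>: "definable (\<lambda>x z y d. \<omega> x y d)"
    and neg: "valid K (\<lambda>y d. J y d \<and> \<not> \<omega> a y d)"
    and no: "\<And>\<Lambda>. definable (\<lambda>x z y d. \<Lambda> y d) \<Longrightarrow>
      \<not> valid (\<lambda>z d. K z (ev d) \<and> non_isolating \<omega> \<Lambda> z d) (\<lambda>y d. J y (ev d) \<and> \<Lambda> y d)"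
  shows "definable (\<lambda>x z y d. X0 x) \<Longrightarrow> X0 a \<Longrightarrow>
    \<exists>p q. (\<forall>k<n. p k \<in> vals (vals A) \<and> q k \<in> vals A) \<and>
      (\<forall>E\<subseteq>{..<n}. \<exists>x\<in>vals (carrier U). X0 x \<and> (\<forall>k<n. \<omega> x (p k) (q k) \<longleftrightarrow> k \<in> E))"
proof (induction n arbitrary: X0)
  case 0
  then show ?case using a_vals by auto
next
  case (Suc n)
  \<comment> \<open>Compression over \<open>B\<close> of the instances of the negation of \<omega>;
    it will make the last point fail \<omega>.\<close>
  obtain \<psi>' where \<psi>': "definable (\<lambda>x z y d. \<psi>' x z)" and
    \<psi>'_iso: "\<forall>B0\<subseteq>B. \<forall>d\<in>vals B. finite B0 \<longrightarrow> (\<exists>e\<in>vals B. \<psi>' a e \<and>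
      (\<forall>y\<in>vals (vals B0). \<not> \<omega> a y d \<longrightarrow> (\<forall>x\<in>vals (carrier U). \<psi>' x e \<longrightarrow> \<not> \<omega> x y d)))"
    using compressible_definable[OF comp _ definable_neg[OF \<omega>]] u0_B by blast
  define pat where "pat E x d \<longleftrightarrow> (\<forall>k\<in>{..<n}. \<omega> x (dec_y k (od d)) (dec_d k (od d)) \<longleftrightarrow> k \<in> E)" for E x d
  \<comment> \<open>The bad candidates for the last point: some pattern on the earlier points cannot
    be combined with \<omega> at \<open>y\<close>. The even half of \<open>d\<close> belongs to
    \<open>y\<close>, the odd half codes the earlier points.\<close>
  define \<Lambda> where "\<Lambda> y d \<longleftrightarrow> (\<exists>E\<in>Pow {..<n}. \<not> (\<exists>x\<in>vals (carrier U). X0 x \<and> \<omega> x y (ev d) \<and> pat E x d))" for y d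
  have "definable (\<lambda>x z y d. pat E x d)" for E
    unfolding pat_def by (intro definable_ball definable_iff definable_dec[OF \<omega>] definable_const) simp
  then have "definable (\<lambda>x z y d. X0 x \<and> \<omega> x y (ev d) \<and> pat E x d)" for E
    by (intro definable_conj Suc.prems(1) definable_param[OF \<omega>]) auto
  then have "definable (\<lambda>x z y d. \<Lambda> y d)"
    unfolding \<Lambda>_def by (intro definable_bex definable_neg definable_exX) simp
  from no[OF this] obtain \<Theta> where \<Theta>: "formulas \<Theta>" and no_cfg: "\<And>A0 Q c d.
      \<not> config \<Theta> (\<lambda>z d. K z (ev d) \<and> non_isolating \<omega> \<Lambda> z d) (\<lambda>y d. J y (ev d) \<and> \<Lambda> y d) A0 Q c d"
    unfolding valid_def by blast
  \<comment> \<open>The configuration is taken against the very \<Theta> that defeats \<Lambda>, so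
    that any strengthening of it by \<Lambda> and \<open>non_isolating\<close> is
    impossible.\<close>
  obtain A0 Q c d where cfg: "config \<Theta> K (\<lambda>y d. J y d \<and> \<not> \<omega> a y d) A0 Q c d"
    using neg \<Theta> unfolding valid_def by blast
  then have A0: "A0 \<subseteq> A" "finite A0" "Q \<subseteq> vals (vals A0)" and c: "c \<in> vals B" "\<psi> a c"
    and d: "d \<in> vals A" and Q: "\<And>y. y \<in> Q \<Longrightarrow> \<not> \<omega> a y d"
    by (simp_all add: config_def)
  obtain e where e: "e \<in> vals B" "\<psi>' a e"
    "\<forall>y\<in>vals (vals A0). \<not> \<omega> a y d \<longrightarrow> (\<forall>x\<in>vals (carrier U). \<psi>' x e \<longrightarrow> \<not> \<omega> x y d)"
    using \<psi>'_iso A0 A_sub vals_mono[OF A_sub d] by (meson order_trans)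
  have e_Q: "\<not> \<omega> x y d" if "y \<in> Q" "x \<in> vals (carrier U)" "\<psi>' x e" for x y
    using e(3) A0(3) Q that by blast
  \<comment> \<open>This is why \<open>X0\<close> is arbitrary in the induction: the earlier points
    are now shattered inside both compressing formulas.\<close>
  have "definable (\<lambda>x z y d. X0 x \<and> \<psi> x c \<and> \<psi>' x e)"
    by (intro definable_conj Suc.prems(1) definable_inst_z[OF \<psi>_def c(1)] definable_inst_z[OF \<psi>' e(1)])
  from Suc.IH[OF this] Suc.prems(2) c(2) e(2) obtain p q where
    pq: "\<forall>k<n. p k \<in> vals (vals A) \<and> q k \<in> vals A" and
    IH: "\<forall>E\<subseteq>{..<n}. \<exists>x\<in>vals (carrier U). (X0 x \<and> \<psi> x c \<and> \<psi>' x e) \<and> (\<forall>k<n. \<omega> x (p k) (q k) \<longleftrightarrow> k \<in> E)"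
    by blast
  obtain d1 where d1: "d1 \<in> vals A" "\<forall>k<n. dec_y k d1 = p k \<and> dec_d k d1 = q k"
    using dec_exists[OF pq u0] by blast
  let ?d = "merge d d1"
  have pat: "pat E x ?d \<longleftrightarrow> (\<forall>k<n. \<omega> x (p k) (q k) \<longleftrightarrow> k \<in> E)" for E x
    using d1(2) by (auto simp: pat_def)
  \<comment> \<open>If all of \<open>Q\<close> were bad, \<open>c\<close> would have to be
    isolating. Then \<psi>(x, c) implies \<omega> at some bad \<open>y\<close>, possibly outside
    \<open>Q\<close>, and the witnesses from the induction hypothesis realise every pattern there,
    so \<open>y\<close> is not bad.\<close>
  have "\<exists>y\<in>Q. \<not> \<Lambda> y ?d"
  proof (rule ccontr)
    assume all: "\<not> (\<exists>y\<in>Q. \<not> \<Lambda> y ?d)"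
    have "\<not> non_isolating \<omega> \<Lambda> c ?d"
    proof
      assume "non_isolating \<omega> \<Lambda> c ?d"
      with all cfg have "config \<Theta> (\<lambda>z d. K z (ev d) \<and> non_isolating \<omega> \<Lambda> z d) (\<lambda>y d. J y (ev d) \<and> \<Lambda> y d) A0 Q c ?d"
        using merge_vals[OF d d1(1)] by (simp add: config_def)
      with no_cfg show False by blast
    qed
    then obtain y where y: "\<Lambda> y ?d" "\<And>x. x \<in> vals (carrier U) \<Longrightarrow> \<psi> x c \<Longrightarrow> \<omega> x y d"
      unfolding non_isolating_def ev_merge by blast
    then obtain E where E: "E \<subseteq> {..<n}" "\<not> (\<exists>x\<in>vals (carrier U). X0 x \<and> \<omega> x y d \<and> pat E x ?d)"
      unfolding \<Lambda>_def ev_merge by blast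
    obtain x where "x \<in> vals (carrier U)" "X0 x" "\<psi> x c" "\<forall>k<n. \<omega> x (p k) (q k) \<longleftrightarrow> k \<in> E"
      using IH E(1) by blast
    with E(2) y(2) pat show False by blast
  qed
  then obtain y where y: "y \<in> Q" "\<And>E. E \<subseteq> {..<n} \<Longrightarrow> \<exists>x\<in>vals (carrier U). X0 x \<and> \<omega> x y d \<and> pat E x ?d"
    unfolding \<Lambda>_def ev_merge by blast
  have "y \<in> vals (vals A)" using y(1) A0(1,3) by (auto simp: vals_iff subset_iff)
  then have "\<forall>k<Suc n. (p(n := y)) k \<in> vals (vals A) \<and> (q(n := d)) k \<in> vals A"
    using pq d by (auto simp: less_Suc_eq)
  moreover have "\<exists>x\<in>vals (carrier U). X0 x \<and> (\<forall>k<Suc n. \<omega> x ((p(n := y)) k) ((q(n := d)) k) \<longleftrightarrow> k \<in> E)"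
    if E: "E \<subseteq> {..<Suc n}" for E
  proof (cases "n \<in> E")
    case True
    obtain x where "x \<in> vals (carrier U)" "X0 x" "\<omega> x y d" "pat (E - {n}) x ?d"
    proof -
      have "E - {n} \<subseteq> {..<n}" using E by (auto simp: lessThan_Suc)
      from y(2)[OF this] show thesis using that by blast
    qed
    with True show ?thesis unfolding pat
      by (intro bexI[of _ x] conjI) (auto simp: less_Suc_eq)
  next
    case False
    then have "E \<subseteq> {..<n}" using E by (auto simp: lessThan_Suc)
    with IH obtain x where "x \<in> vals (carrier U)" "X0 x" "\<psi>' x e" "\<forall>k<n. \<omega> x (p k) (q k) \<longleftrightarrow> k \<in> E"
      by blast
    with False e_Q[OF y(1)] show ?thesis
      by (intro bexI[of _ x] conjI) (auto simp: less_Suc_eq)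
  qed
  ultimately show ?case by blast
qed

text \<open>Here \<omega>(x, y) asserts a suitable \<open>z\<close> with \<psi>(x, z). If \<omega>
  can be made true of \<open>a\<close>, this gives the conclusion directly. Otherwise NIP for
  \<omega> and \<open>shatter_of_isolating\<close> yield some \<Lambda>, and the strengthened
  condition has no realisation of \<rho> at all.\<close>

lemma valid_step:
  assumes K: "definable (\<lambda>x z y d. K z d)" and \<rho>: "definable (\<lambda>x z y d. \<rho> z y)" and valid: "valid K J"
  shows "\<exists>K' J'. definable (\<lambda>x z y d. K' z d) \<and> valid K' J' \<and> (\<forall>z d. K' z d \<longrightarrow> K z (ev d)) \<and>
    (\<forall>y d. J' y d \<longrightarrow> J y (ev d) \<and> ((\<exists>z\<in>vals (carrier U). \<rho> z y \<and> K' z d) \<longrightarrow>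
      (\<exists>z\<in>vals (carrier U). \<psi> a z \<and> \<rho> z y \<and> K z (ev d))))"
proof -
  define \<omega> where "\<omega> x y d \<longleftrightarrow> (\<exists>z\<in>vals (carrier U). \<psi> x z \<and> \<rho> z y \<and> K z d)" for x y d
  have \<omega>_def': "definable (\<lambda>x z y d. \<omega> x y d)"
    unfolding \<omega>_def by (intro definable_exZ definable_conj \<psi>_def K \<rho>)
  have K_ev: "definable (\<lambda>x z y d. K z (ev d))"
  proof -
    have "definable (\<lambda>x z y d. K (\<lambda>j. (\<lambda>x z y d. z j) x z y d) (\<lambda>j. (\<lambda>x z y d. d (2 * j)) x z y d))"
      by (rule definable_subst[where P="\<lambda>x z y d. K z d" and fy="\<lambda>k j x z y d. y k j"]) (simp_all add: K)
    then show ?thesis by (simp add: ev_def)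
  qed
  show ?thesis
  proof (cases "valid K (\<lambda>y d. J y d \<and> \<omega> a y d)")
    case True
    show ?thesis
      by (intro exI[of _ "\<lambda>z d. K z (ev d)"] exI[of _ "\<lambda>y d. J y (ev d) \<and> \<omega> a y (ev d)"] conjI K_ev valid_ev[OF True])
        (auto simp: \<omega>_def)
  next
    case False
    with valid_split[OF valid] have neg: "valid K (\<lambda>y d. J y d \<and> \<not> \<omega> a y d)" by blast
    have "\<exists>\<Lambda>. definable (\<lambda>x z y d. \<Lambda> y d) \<and>
      valid (\<lambda>z d. K z (ev d) \<and> non_isolating \<omega> \<Lambda> z d) (\<lambda>y d. J y (ev d) \<and> \<Lambda> y d)"
    proof (rule ccontr)
      assume no: "\<not> ?thesis"
      obtain N :: nat where N: "\<forall>p q. (\<forall>k<N. p k \<in> vals (vals (carrier U)) \<and> q k \<in> vals (carrier U)) \<longrightarrow>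
          \<not> (\<forall>E\<subseteq>{..<N}. \<exists>x\<in>vals (carrier U). \<forall>k<N. \<omega> x (p k) (q k) \<longleftrightarrow> k \<in> E)"
        using definable_nip_x[OF nip \<omega>_def'] by blast
      have "\<exists>p q. (\<forall>k<N. p k \<in> vals (vals A) \<and> q k \<in> vals A) \<and>
          (\<forall>E\<subseteq>{..<N}. \<exists>x\<in>vals (carrier U). True \<and> (\<forall>k<N. \<omega> x (p k) (q k) \<longleftrightarrow> k \<in> E))"
        by (rule shatter_of_isolating[OF \<omega>_def' neg _ definable_const]) (use no in blast)+
      then obtain p q where pq: "\<forall>k<N. p k \<in> vals (vals A) \<and> q k \<in> vals A"
          "\<forall>E\<subseteq>{..<N}. \<exists>x\<in>vals (carrier U). \<forall>k<N. \<omega> x (p k) (q k) \<longleftrightarrow> k \<in> E" by auto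
      have "\<forall>k<N. p k \<in> vals (vals (carrier U)) \<and> q k \<in> vals (carrier U)"
        using pq(1) A_carrier by (auto simp: vals_iff)
      with N pq(2) show False by blast
    qed
    then obtain \<Lambda> where \<Lambda>: "definable (\<lambda>x z y d. \<Lambda> y d)"
        "valid (\<lambda>z d. K z (ev d) \<and> non_isolating \<omega> \<Lambda> z d) (\<lambda>y d. J y (ev d) \<and> \<Lambda> y d)" by blast
    let ?K = "\<lambda>z d. K z (ev d) \<and> non_isolating \<omega> \<Lambda> z d"
    \<comment> \<open>The last conjunct is recorded because \<open>non_isolating\<close> speaks only
      about rows from the carrier.\<close>
    let ?J = "\<lambda>y d. J y (ev d) \<and> \<Lambda> y d \<and> y \<in> vals (vals (carrier U))"
    have "definable (\<lambda>x z y d. ?K z d)"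
      unfolding non_isolating_def
      by (intro definable_conj K_ev definable_allY definable_imp \<Lambda>(1) definable_exX \<psi>_def definable_neg
          definable_param[OF \<omega>_def']) simp
    moreover have "valid ?K ?J"
      by (rule valid_mono[OF \<Lambda>(2)]) (use A_carrier in \<open>auto simp: vals_iff\<close>)
    moreover have "\<not> (\<exists>z\<in>vals (carrier U). \<rho> z y \<and> ?K z d)" if J: "?J y d" for y d
    proof
      assume "\<exists>z\<in>vals (carrier U). \<rho> z y \<and> ?K z d"
      then obtain z where z: "z \<in> vals (carrier U)" "\<rho> z y" "K z (ev d)" "non_isolating \<omega> \<Lambda> z d" by blast
      \<comment> \<open>\<open>z\<close> itself witnesses \<omega> for every \<open>x\<close> with
        \<psi>(x, z), contrary to the choice of this \<open>x\<close>.\<close>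
      then obtain x where "x \<in> vals (carrier U)" "\<psi> x z" "\<not> \<omega> x y (ev d)"
        using J unfolding non_isolating_def by blast
      with z show False by (auto simp: \<omega>_def)
    qed
    ultimately show ?thesis
      by (intro exI[of _ ?K] exI[of _ ?J]) blast
  qed
qed

section \<open>Realising all patterns\<close>

lemma definable_\<zeta>: "definable (\<lambda>x z y d. \<zeta> z (y k))"
proof -
  have "definable (\<lambda>x z y d. \<phi> x (\<lambda>j. (\<lambda>k' j x z y d. y k j) (0::nat) j x z y d))"
    by (rule definable_subst[where P="\<lambda>x z y d. \<phi> x (y 0)" and fy="\<lambda>k' j x z y d. y k j"
        and fz="\<lambda>j x z y d. z j" and fd="\<lambda>j x z y d. d j"]) (simp_all add: \<phi>_def)
  then have "definable (\<lambda>x z y d. \<phi> x (y k))" by simp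
  then show ?thesis
    unfolding \<zeta>_def by (intro definable_allX definable_imp \<psi>_def)
qed

definition pattern :: "nat set \<Rightarrow> (nat \<Rightarrow> 'u) \<Rightarrow> (nat \<Rightarrow> nat \<Rightarrow> 'u) \<Rightarrow> bool" where
  "pattern S z y \<longleftrightarrow> (\<forall>j\<in>{..<M}. \<zeta> z (y j) \<longleftrightarrow> j \<notin> S)"

lemma definable_pattern: "definable (\<lambda>x z y d. pattern S z y)"
  unfolding pattern_def by (intro definable_ball definable_iff definable_\<zeta> definable_const) simp

text \<open>\<open>valid_step\<close> is iterated by dependent choice. The parameters of each stage
  are the even half of those of the next, so the last sequence determines all earlier ones.\<close>

lemma valid_chain: "\<exists>K J. (\<forall>t. definable (\<lambda>x z y d. K t z d) \<and> valid (K t) (J t)) \<and>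
    (\<forall>t z d. K (Suc t) z d \<longrightarrow> K t z (ev d)) \<and>
    (\<forall>t y d. J (Suc t) y d \<longrightarrow> J t y (ev d) \<and> ((\<exists>z\<in>vals (carrier U). pattern (S t) z y \<and> K (Suc t) z d) \<longrightarrow>
      (\<exists>z\<in>vals (carrier U). \<psi> a z \<and> pattern (S t) z y \<and> K t z (ev d))))"
proof -
  let ?P = "\<lambda>(t::nat) KJ. definable (\<lambda>x z y d. fst KJ z d) \<and> valid (fst KJ) (snd KJ)"
  let ?Q = "\<lambda>t KJ KJ'. (\<forall>z d. fst KJ' z d \<longrightarrow> fst KJ z (ev d)) \<and>
    (\<forall>y d. snd KJ' y d \<longrightarrow> snd KJ y (ev d) \<and> ((\<exists>z\<in>vals (carrier U). pattern (S t) z y \<and> fst KJ' z d) \<longrightarrow>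
      (\<exists>z\<in>vals (carrier U). \<psi> a z \<and> pattern (S t) z y \<and> fst KJ z (ev d))))"
  have "\<exists>f. \<forall>t. ?P t (f t) \<and> ?Q t (f t) (f (Suc t))"
  proof (rule dependent_nat_choice)
    show "\<exists>KJ. ?P 0 KJ"
      by (rule exI[of _ "(\<lambda>_ _. True, \<lambda>_ _. True)"]) (simp add: valid_init definable_const)
    fix KJ t assume "?P t KJ"
    from valid_step[OF conjunct1[OF this] definable_pattern[of "S t"] conjunct2[OF this]]
    obtain K' J' where "definable (\<lambda>x z y d. K' z d)" "valid K' J'" "?Q t KJ (K', J')" by auto
    then show "\<exists>KJ'. ?P (Suc t) KJ' \<and> ?Q t KJ KJ'" by (intro exI[of _ "(K', J')"]) simp
  qed
  then obtain f where "\<forall>t. ?P t (f t) \<and> ?Q t (f t) (f (Suc t))" ..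
  then show ?thesis
    by (intro exI[of _ "\<lambda>t. fst (f t)"] exI[of _ "\<lambda>t. snd (f t)"]) blast
qed

text \<open>With this order \<open>S - {i}\<close> is treated later than \<open>S\<close>, so the
  conditions on its realisation include those imposed for \<open>S\<close>.\<close>

lemma sorted_subsets:
  "\<exists>Ss. set Ss = Pow {..<M} \<and> (\<forall>t<length Ss. \<forall>t'<length Ss. card (Ss ! t') < card (Ss ! t) \<longrightarrow> t < t')"
proof -
  obtain Ss0 where Ss0: "set Ss0 = Pow {..<M}" using finite_list[of "Pow {..<M}"] by auto
  define Ss where "Ss = sort_key (\<lambda>S. M - card S) Ss0"
  have sorted: "sorted (map (\<lambda>S. M - card S) Ss)" by (simp add: Ss_def)
  have set: "set Ss = Pow {..<M}" by (simp add: Ss_def Ss0)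
  have "t < t'" if t: "t < length Ss" "t' < length Ss" "card (Ss ! t') < card (Ss ! t)" for t t'
  proof (rule ccontr)
    assume "\<not> t < t'"
    then have "M - card (Ss ! t') \<le> M - card (Ss ! t)"
      using sorted_nth_mono[OF sorted, of t' t] t by simp
    moreover have "Ss ! t \<subseteq> {..<M}" using set t(1) nth_mem[of t Ss] by blast
    then have "card (Ss ! t) \<le> M" using card_mono[of "{..<M}" "Ss ! t"] by simp
    ultimately show False using t(3) by linarith
  qed
  with set show ?thesis by blast
qed

text \<open>One tuple \<open>y\<close> undecided for all relevant formulas is fixed first. Patterns
  are then realised by induction on their size, starting with \<open>c\<close> for the empty set;
  each step makes \<zeta> fail at one more point and returns from another \<open>x\<close> to
  \<open>a\<close> by \<open>J_Suc\<close>.\<close>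

lemma all_patterns:
  "\<exists>y\<in>vals (vals (carrier U)). \<forall>S\<subseteq>{..<M}. \<exists>z\<in>vals (carrier U). pattern S z y"
proof -
  from sorted_subsets obtain Ss where Ss: "set Ss = Pow {..<M}"
    "\<forall>t<length Ss. \<forall>t'<length Ss. card (Ss ! t') < card (Ss ! t) \<longrightarrow> t < t'"
    by (elim exE conjE) (rule that)
  define T where "T = length Ss"
  from valid_chain[of "\<lambda>t. Ss ! t"] obtain K J where
    KJ: "\<forall>t. definable (\<lambda>x z y d. K t z d) \<and> valid (K t) (J t)" and
    K_Suc: "\<forall>t z d. K (Suc t) z d \<longrightarrow> K t z (ev d)" and
    J_Suc: "\<forall>t y d. J (Suc t) y d \<longrightarrow> J t y (ev d) \<and>
      ((\<exists>z\<in>vals (carrier U). pattern (Ss ! t) z y \<and> K (Suc t) z d) \<longrightarrow>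
      (\<exists>z\<in>vals (carrier U). \<psi> a z \<and> pattern (Ss ! t) z y \<and> K t z (ev d)))"
    by (elim exE conjE) (rule that)
  \<comment> \<open>The parameters of stage \<open>t\<close>, recovered from those of the last stage
    \<open>T\<close>.\<close>
  define D where "D t d = (ev ^^ (T - t)) d" for t and d :: "nat \<Rightarrow> 'u"
  have D_Suc: "D t d = ev (D (Suc t) d)" if "t < T" for t d
  proof -
    have "T - t = Suc (T - Suc t)" using that by simp
    then show ?thesis by (simp add: D_def)
  qed
  have K_le: "t \<le> t' \<Longrightarrow> t' \<le> T \<Longrightarrow> K t' z (D t' d) \<Longrightarrow> K t z (D t d)" for t t' z d
  proof (induction t' rule: dec_induct)
    case (step n)
    then show ?case using K_Suc D_Suc[of n d] by simp
  qed
  have D_param: "definable (\<lambda>x z y d. P x z y (D t d))" if "definable P" for P t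
  proof -
    have "\<exists>r. ev ^^ n = (\<lambda>(d :: nat \<Rightarrow> 'u) j. d (r j))" for n
    proof (induction n)
      case 0
      show ?case by (rule exI[of _ "\<lambda>j. j"]) (simp add: fun_eq_iff)
    next
      case (Suc n)
      then obtain r where r: "ev ^^ n = (\<lambda>(d :: nat \<Rightarrow> 'u) j. d (r j))" ..
      have "(ev ^^ Suc n) d j = d (r (2 * j))" for d :: "nat \<Rightarrow> 'u" and j
        by (simp add: r) (simp add: ev_def)
      then show ?case by (intro exI[of _ "\<lambda>j. r (2 * j)"]) (simp only: fun_eq_iff simp_thms)
    qed
    then obtain r where r: "ev ^^ (T - t) = (\<lambda>(d :: nat \<Rightarrow> 'u) j. d (r j))" by blast
    have "definable (\<lambda>x z y d. P x (\<lambda>j. (\<lambda>x z y d. z j) x z y d) (\<lambda>k j. (\<lambda>x z y d. y k j) x z y d)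
        (\<lambda>j. (\<lambda>x z y d. d (r j)) x z y d))"
      by (rule definable_subst) (simp_all add: that)
    then show ?thesis by (simp add: D_def r)
  qed
  \<comment> \<open>Leaving out \<open>j = i\<close> makes the formula independent of row
    \<open>i\<close>, so that \<open>undecided\<close> can be applied to it.\<close>
  define \<theta> where "\<theta> S i t x y d \<longleftrightarrow> (\<exists>z\<in>vals (carrier U). \<psi> x z \<and>
    (\<forall>j\<in>{..<M} - {i}. \<zeta> z (y j) \<longleftrightarrow> j \<notin> S) \<and> K t z (D t d))" for S i t x y d
  define \<Theta> where "\<Theta> = (\<lambda>(S, i, t). \<theta> S i t) ` (Pow {..<M} \<times> {..<M} \<times> {..T})"
  have "definable (\<lambda>x z y d. \<theta> S i t x y d)" for S i t
    unfolding \<theta>_def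
    by (intro definable_exZ definable_conj \<psi>_def definable_ball definable_iff definable_\<zeta> definable_const
        D_param[where P="\<lambda>x z y d. K t z d"]) (simp_all add: KJ)
  then have "formulas \<Theta>" by (auto simp: formulas_def \<Theta>_def)
  then obtain A0 Q c d where cfg: "config \<Theta> (K T) (J T) A0 Q c d"
    using KJ unfolding valid_def by blast
  then obtain y where y: "y \<in> Q" "\<And>i. i < M \<Longrightarrow> undecided \<Theta> y d i"
    unfolding config_def universal_def by blast
  have y_vals: "y \<in> vals (vals (carrier U))"
    using cfg y(1) A_carrier by (auto simp: config_def vals_iff subset_iff)
  have c: "c \<in> vals (carrier U)" "\<psi> a c" "\<And>i. i < M \<Longrightarrow> \<zeta> c (y i)" "K T c (D T d)"
    using cfg y(1) vals_mono[OF B_carrier, of c] by (simp_all add: config_def D_def)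
  have J_le: "t \<le> T \<Longrightarrow> J t y (D t d)" for t
  proof (induction rule: inc_induct)
    case base
    show ?case using cfg y(1) by (simp add: config_def D_def)
  next
    case (step n)
    then show ?case using J_Suc D_Suc[of n d] by simp
  qed
  \<comment> \<open>A nonempty \<open>S\<close> is realised with the condition of its own stage,
    since its step gives up the strengthening made there. The empty set is realised by
    \<open>c\<close> at the final stage \<open>T\<close>.\<close>
  have main: "S \<subseteq> {..<M} \<Longrightarrow> \<exists>z\<in>vals (carrier U). pattern S z y \<and> \<psi> a z \<and>
      (\<exists>t\<le>T. (S \<noteq> {} \<longrightarrow> t < T \<and> Ss ! t = S) \<and> (S = {} \<longrightarrow> t = T) \<and> K t z (D t d))" for S
  proof (induction "card S" arbitrary: S)
    case 0
    then have "S = {}" using finite_subset[OF 0(2)] by simp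
    then show ?case using c by (auto simp: pattern_def)
  next
    case (Suc n)
    then obtain i where i: "i \<in> S" by fastforce
    have iM: "i < M" using i Suc.prems by blast
    have fin: "finite S" using finite_subset[OF Suc.prems] by simp
    have "S \<in> set Ss" using Ss(1) Suc.prems by simp
    then obtain t where t: "t < T" "Ss ! t = S" by (auto simp: in_set_conv_nth T_def)
    have card: "n = card (S - {i})" using Suc.hyps(2) i fin by simp
    from Suc.hyps(1)[OF this] Suc.prems obtain z t' where z: "z \<in> vals (carrier U)" "pattern (S - {i}) z y" "\<psi> a z"
      and t': "t' \<le> T" "S - {i} \<noteq> {} \<longrightarrow> t' < T \<and> Ss ! t' = S - {i}" "S - {i} = {} \<longrightarrow> t' = T" "K t' z (D t' d)"
      by blast
    have "t < t'"
    proof (cases "S - {i} = {}")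
      case False
      with t' have "t' < T" "Ss ! t' = S - {i}" by auto
      then show ?thesis using Ss(2)[rule_format, of t t'] t card Suc.hyps(2) by (simp add: T_def)
    qed (use t t' in simp)
    then have Kz: "K (Suc t) z (D (Suc t) d)" using K_le[OF _ t'(1,4)] by simp
    \<comment> \<open>Away from \<open>i\<close>, neither overwriting row \<open>i\<close> nor
      deleting \<open>i\<close> from \<open>S\<close> makes a difference.\<close>
    have upd: "(\<forall>j\<in>{..<M} - {i}. \<zeta> z ((y(i := \<lambda>_. u0)) j) \<longleftrightarrow> j \<notin> S - {i}) \<longleftrightarrow>
        (\<forall>j\<in>{..<M} - {i}. \<zeta> z (y j) \<longleftrightarrow> j \<notin> S)" for z
      by auto
    have "\<theta> (S - {i}) i (Suc t) a (y(i := \<lambda>_. u0)) d"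
      unfolding \<theta>_def upd using z Kz by (auto simp: pattern_def)
    moreover have "\<theta> (S - {i}) i (Suc t) \<in> \<Theta>"
      unfolding \<Theta>_def using Suc.prems iM t(1) by (intro image_eqI[of _ _ "(S - {i}, i, Suc t)"]) auto
    ultimately obtain x where x: "x \<in> vals (carrier U)" "\<not> \<phi> x (y i)" "\<theta> (S - {i}) i (Suc t) x (y(i := \<lambda>_. u0)) d"
      using y(2)[OF iM] unfolding undecided_def by blast
    then obtain z' where z': "z' \<in> vals (carrier U)" "\<psi> x z'" "\<forall>j\<in>{..<M} - {i}. \<zeta> z' (y j) \<longleftrightarrow> j \<notin> S"
        "K (Suc t) z' (D (Suc t) d)"
      unfolding \<theta>_def upd by blast
    \<comment> \<open>The undecided instance supplies the failure: \<open>x\<close> satisfies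
      \<psi>(x, z') but not \<phi>.\<close>
    have "\<not> \<zeta> z' (y i)" using x(1,2) z'(2) unfolding \<zeta>_def by blast
    then have "pattern S z' y" using z'(3) i unfolding pattern_def by blast
    \<comment> \<open>\<open>z'\<close> goes with \<open>x\<close> rather than \<open>a\<close>; its
      condition at \<open>Suc t\<close> allows it to be exchanged for one that goes with
      \<open>a\<close>, at the cost of one stage.\<close>
    then have "\<exists>z\<in>vals (carrier U). \<psi> a z \<and> pattern S z y \<and> K t z (D t d)"
      using J_Suc[rule_format, OF J_le[of "Suc t"]] t z'(1,4) D_Suc[OF t(1)] by auto
    then show ?case using t i by (auto intro!: exI[of _ t])
  qed
  show ?thesis using y_vals main by blast
qed

lemma \<zeta>_shattered:
  "\<exists>p. (\<forall>k<M. p k \<in> vals (carrier U)) \<and>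
    (\<forall>E\<subseteq>{..<M}. \<exists>z\<in>vals (carrier U). \<forall>k<M. \<zeta> z (p k) \<longleftrightarrow> k \<in> E)"
proof -
  obtain y where y: "y \<in> vals (vals (carrier U))"
    "\<And>S. S \<subseteq> {..<M} \<Longrightarrow> \<exists>z\<in>vals (carrier U). pattern S z y"
    using all_patterns by blast
  \<comment> \<open>A pattern lists the points where \<zeta> fails, hence the complement.\<close>
  have "\<exists>z\<in>vals (carrier U). \<forall>k<M. \<zeta> z (y k) \<longleftrightarrow> k \<in> E" if "E \<subseteq> {..<M}" for E
    using y(2)[of "{..<M} - E"] by (auto simp: pattern_def)
  with y(1) show ?thesis by (auto simp: vals_iff[of y])
qed

end

section \<open>Contradiction with NIP for \<zeta>\<close>

context compressible_type
begin

text \<open>If it failed, \<zeta> would shatter \<open>M\<close> points for every \<open>M\<close>,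
  contrary to NIP.\<close>

lemma one_sided:
  assumes \<phi>: "definable (\<lambda>x z y d. \<phi> x (y 0))"
  shows "one_sided \<phi>"
proof (rule ccontr)
  assume not: "\<not> one_sided \<phi>"
  obtain u0 where u0: "u0 \<in> A" using A_ne by blast
  have "B \<noteq> {}" using u0 A_sub by blast
  from compressible_definable[OF comp this \<phi>]
  obtain \<psi> where \<psi>: "definable (\<lambda>x z y d. \<psi> x z)" and
    iso: "\<forall>B0\<subseteq>B. \<forall>d\<in>(vals B :: (nat \<Rightarrow> 'u) set). finite B0 \<longrightarrow> (\<exists>c\<in>vals B. \<psi> a c \<and>
      (\<forall>y\<in>(vals (vals B0) :: (nat \<Rightarrow> nat \<Rightarrow> 'u) set). \<phi> a (y 0) \<longrightarrow> (\<forall>x\<in>vals (carrier U). \<psi> x c \<longrightarrow> \<phi> x (y 0))))"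
    by (elim exE conjE) (rule that)
  have iso': "\<exists>c\<in>vals B. \<psi> a c \<and> (\<forall>b\<in>vals B0. \<phi> a b \<longrightarrow> (\<forall>x\<in>vals (carrier U). \<psi> x c \<longrightarrow> \<phi> x b))"
    if B0: "B0 \<subseteq> B" "finite B0" for B0
  proof -
    \<comment> \<open>\<phi> reads only row 0, so the parameter sequence and the other rows may be
      filled arbitrarily.\<close>
    have "(\<lambda>_. u0) \<in> (vals B :: (nat \<Rightarrow> 'u) set)" using u0 A_sub by (auto simp: vals_iff)
    with iso B0 obtain c where c: "c \<in> vals B" "\<psi> a c"
      "\<forall>y\<in>(vals (vals B0) :: (nat \<Rightarrow> nat \<Rightarrow> 'u) set). \<phi> a (y 0) \<longrightarrow> (\<forall>x\<in>vals (carrier U). \<psi> x c \<longrightarrow> \<phi> x (y 0))" by blast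
    have "\<forall>x\<in>vals (carrier U). \<psi> x c \<longrightarrow> \<phi> x b" if "b \<in> vals B0" "\<phi> a b" for b
      using c(3)[rule_format, of "\<lambda>_. b"] that by (auto simp: vals_iff)
    with c show ?thesis by blast
  qed
  \<comment> \<open>\<open>\<zeta>\<close> does not depend on \<open>M\<close>, which can be chosen once the bound for \<open>\<zeta>\<close> is known.\<close>
  interpret not_one_sided L U I B A a \<phi> \<psi> 0 u0
    by unfold_locales (use \<phi> not \<psi> iso' u0 in auto)
  obtain N :: nat where N: "\<forall>p. (\<forall>k<N. p k \<in> vals (carrier U)) \<longrightarrow>
    \<not> (\<forall>E\<subseteq>{..<N}. \<exists>z\<in>vals (carrier U). \<forall>k<N. \<zeta> z (p k) \<longleftrightarrow> k \<in> E)"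
    using definable_nip_z[OF nip definable_\<zeta>] by blast
  interpret N: not_one_sided L U I B A a \<phi> \<psi> N u0
    by unfold_locales
  show False using N.\<zeta>_shattered N by blast
qed

end

section \<open>Compressibility up to B\<close>

lemma holds_cong:
  assumes "part_fm L I n \<phi>" "\<And>i. i \<in> I \<Longrightarrow> a i = a' i"
  shows "holds M a (\<phi>, b) = holds M a' (\<phi>, b)"
  unfolding holds_def prod.case
  by (rule sat_cong) (use assms in \<open>auto simp: part_fm_def\<close>)

context compressible_type
begin

lemma definable_interleave:
  assumes "definable (\<lambda>x z y d. P x y d)" "f = ev \<or> f = od"
  shows "definable (\<lambda>x z y d. P x (\<lambda>k. f (y k)) (f d))"
proof -
  have "ev = (\<lambda>(d :: nat \<Rightarrow> 'u) j. d (2 * j))" "od = (\<lambda>(d :: nat \<Rightarrow> 'u) j. d (Suc (2 * j)))"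
    by (simp_all add: ev_def od_def fun_eq_iff)
  with assms(2) obtain r where r: "f = (\<lambda>d j. d (r j))" by metis
  have "definable (\<lambda>x z y d. P x (\<lambda>k j. (\<lambda>x z y d. y k (r j)) x z y d) (\<lambda>j. (\<lambda>x z y d. d (r j)) x z y d))"
    by (rule definable_subst[where P="\<lambda>x z y d. P x y d" and fz="\<lambda>j x z y d. z j"]) (simp_all add: assms)
  then show ?thesis by (simp add: r)
qed

text \<open>The conjunction of the formulas for \<phi> and for its negation, with their parameters
  interleaved entry by entry.\<close>

lemma two_sided:
  assumes \<phi>: "definable (\<lambda>x z y d. \<phi> x (y 0))"
  shows "\<exists>\<chi>. definable (\<lambda>x z y d. \<chi> x y d) \<and>
    (\<forall>A0\<subseteq>A. finite A0 \<longrightarrow> (\<exists>y\<in>vals (vals A). \<exists>d\<in>vals A. \<chi> a y d \<and>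
      (\<forall>b\<in>vals A0. \<forall>x\<in>vals (carrier U). \<chi> x y d \<longrightarrow> (\<phi> x b \<longleftrightarrow> \<phi> a b))))"
proof -
  obtain \<chi>1 where \<chi>1: "definable (\<lambda>x z y d. \<chi>1 x y d)" and
    1: "\<forall>A0\<subseteq>A. finite A0 \<longrightarrow> (\<exists>y\<in>vals (vals A). \<exists>d\<in>vals A. \<chi>1 a y d \<and>
        (\<forall>b\<in>vals A0. \<phi> a b \<longrightarrow> (\<forall>x\<in>vals (carrier U). \<chi>1 x y d \<longrightarrow> \<phi> x b)))"
    using one_sided[OF \<phi>] unfolding one_sided_def by (elim exE conjE) (rule that)
  obtain \<chi>2 where \<chi>2: "definable (\<lambda>x z y d. \<chi>2 x y d)" and
    2: "\<forall>A0\<subseteq>A. finite A0 \<longrightarrow> (\<exists>y\<in>vals (vals A). \<exists>d\<in>vals A. \<chi>2 a y d \<and>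
        (\<forall>b\<in>vals A0. \<not> \<phi> a b \<longrightarrow> (\<forall>x\<in>vals (carrier U). \<chi>2 x y d \<longrightarrow> \<not> \<phi> x b)))"
    using one_sided[of "\<lambda>x b. \<not> \<phi> x b", OF definable_neg[OF \<phi>]]
    unfolding one_sided_def by (elim exE conjE) (rule that)
  let ?\<chi> = "\<lambda>x y d. \<chi>1 x (\<lambda>k. ev (y k)) (ev d) \<and> \<chi>2 x (\<lambda>k. od (y k)) (od d)"
  have "definable (\<lambda>x z y d. ?\<chi> x y d)"
    by (rule definable_conj[OF definable_interleave[OF \<chi>1] definable_interleave[OF \<chi>2]]) simp_all
  moreover have "\<exists>y\<in>vals (vals A). \<exists>d\<in>vals A. ?\<chi> a y d \<and>
      (\<forall>b\<in>vals A0. \<forall>x\<in>vals (carrier U). ?\<chi> x y d \<longrightarrow> (\<phi> x b \<longleftrightarrow> \<phi> a b))"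
    if A0: "A0 \<subseteq> A" "finite A0" for A0
  proof -
    obtain y1 d1 where y1: "y1 \<in> vals (vals A)" "d1 \<in> vals A" "\<chi>1 a y1 d1"
      "\<forall>b\<in>vals A0. \<phi> a b \<longrightarrow> (\<forall>x\<in>vals (carrier U). \<chi>1 x y1 d1 \<longrightarrow> \<phi> x b)"
      using 1[rule_format, OF A0] by (elim bexE conjE) (rule that)
    obtain y2 d2 where y2: "y2 \<in> vals (vals A)" "d2 \<in> vals A" "\<chi>2 a y2 d2"
      "\<forall>b\<in>vals A0. \<not> \<phi> a b \<longrightarrow> (\<forall>x\<in>vals (carrier U). \<chi>2 x y2 d2 \<longrightarrow> \<not> \<phi> x b)"
      using 2[rule_format, OF A0] by (elim bexE conjE) (rule that)
    have "(\<lambda>k. merge (y1 k) (y2 k)) \<in> vals (vals A)"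
      using y1(1) y2(1) merge_vals unfolding vals_iff[where S="vals A"] by blast
    moreover have "merge d1 d2 \<in> vals A" using y1(2) y2(2) by (rule merge_vals)
    moreover have "\<forall>b\<in>vals A0. \<forall>x\<in>vals (carrier U). \<chi>1 x y1 d1 \<and> \<chi>2 x y2 d2 \<longrightarrow> (\<phi> x b \<longleftrightarrow> \<phi> a b)"
      using y1(4) y2(4) by blast
    ultimately show ?thesis using y1(3) y2(3)
      by (intro bexI[of _ "\<lambda>k. merge (y1 k) (y2 k)"] bexI[of _ "merge d1 d2"]) simp_all
  qed
  ultimately show ?thesis by (intro exI[of _ ?\<chi>]) blast
qed

text \<open>Translates \<open>two_sided\<close> back into formulas. An element of \<open>A\<close>
  is needed to pad finite tuples to sequences within \<open>A\<close>.\<close>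

lemma compressible_up_to_nonempty: "compressible_up_to L U I a A B"
  unfolding compressible_up_to_def compressible_def
proof (intro allI impI)
  fix n and \<phi> :: "('f + 'u, 'r, 'i + nat) fm"
  assume \<phi>: "part_fm (lang_consts L B) I n \<phi>"
  obtain s0 where s0: "s0 \<in> A" using A_ne by blast
  obtain u1 where u1: "u1 \<in> carrier U" using carrier_ne by blast
  define P where "P x b = sat (struct_consts U) (case_sum x b) \<phi>" for x b
  have P_holds: "holds (struct_consts U) x (\<phi>, b) \<longleftrightarrow> P x (\<lambda>j. if j < n then b ! j else s0)" for x b
    unfolding P_def holds_def prod.case
    by (rule sat_cong) (use \<phi> in \<open>auto simp: part_fm_def\<close>)
  from two_sided[of P, OF definable_of_part_fm[OF \<phi>, folded P_def]] obtain Q where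
    Q: "definable (\<lambda>x z y d. Q x y d)" and
    iso: "\<forall>A0\<subseteq>A. finite A0 \<longrightarrow> (\<exists>y\<in>vals (vals A). \<exists>d\<in>vals A. Q a y d \<and>
      (\<forall>b\<in>vals A0. \<forall>x\<in>vals (carrier U). Q x y d \<longrightarrow> (P x b \<longleftrightarrow> P a b)))"
    by (elim exE conjE) (rule that)
  from part_fm_of_definable[OF Q s0] obtain m \<chi> where \<chi>: "part_fm (lang_consts L B) I m \<chi>" and
    \<chi>_holds: "\<forall>y\<in>vals (vals A). \<forall>d\<in>vals A. \<exists>c\<in>tuples A m. \<forall>x. holds (struct_consts U) x (\<chi>, c) \<longleftrightarrow> Q x y d"
    by (elim exE conjE) (rule that)
  show "\<exists>m \<psi>. part_fm (lang_consts L B) I m \<psi> \<and> (\<forall>B\<^sub>0. finite B\<^sub>0 \<and> B\<^sub>0 \<subseteq> A \<longrightarrow>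
      (\<exists>c\<in>tuples A m. holds (struct_consts U) a (\<psi>, c) \<and> implies_in (struct_consts U) I (\<psi>, c)
        ({(\<phi>, b) |b. b \<in> tuples B\<^sub>0 n \<and> holds (struct_consts U) a (\<phi>, b)} \<union>
         {(Neg \<phi>, b) |b. b \<in> tuples B\<^sub>0 n \<and> \<not> holds (struct_consts U) a (\<phi>, b)})))"
  proof (intro exI conjI allI impI)
    show "part_fm (lang_consts L B) I m \<chi>" by (rule \<chi>)
    fix B\<^sub>0 assume B\<^sub>0: "finite B\<^sub>0 \<and> B\<^sub>0 \<subseteq> A"
    \<comment> \<open>The padding element is added so that padded tuples from the given finite set
      lie in the set being compressed.\<close>
    then have "insert s0 B\<^sub>0 \<subseteq> A" "finite (insert s0 B\<^sub>0)" using s0 by auto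
    from iso[rule_format, OF this] obtain y d where y: "y \<in> vals (vals A)" "d \<in> vals A" "Q a y d"
      "\<forall>b\<in>vals (insert s0 B\<^sub>0). \<forall>x\<in>vals (carrier U). Q x y d \<longrightarrow> (P x b \<longleftrightarrow> P a b)"
      by (elim bexE conjE) (rule that)
    from \<chi>_holds[rule_format, OF y(1,2)] obtain c where
      c: "c \<in> tuples A m" "\<forall>x. holds (struct_consts U) x (\<chi>, c) \<longleftrightarrow> Q x y d" ..
    have dec: "holds (struct_consts U) x (\<phi>, b) \<longleftrightarrow> holds (struct_consts U) a (\<phi>, b)"
      if x: "x \<in> I \<rightarrow> carrier U" "holds (struct_consts U) x (\<chi>, c)" and b: "b \<in> tuples B\<^sub>0 n" for x b
    proof -
      \<comment> \<open>\<open>x\<close> is constrained on \<open>I\<close> only; outside it is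
        replaced by an element of the carrier, which changes the truth of neither formula.\<close>
      define x' where "x' i = (if i \<in> I then x i else u1)" for i
      have x'_x: "x' i = x i" if "i \<in> I" for i using that by (simp add: x'_def)
      have x': "x' \<in> vals (carrier U)" using x(1) u1 by (auto simp: x'_def vals_iff)
      have "holds (struct_consts U) x' (\<chi>, c)"
        using x(2) holds_cong[where a=x and a'=x', OF \<chi>] x'_x by simp
      then have "Q x' y d" using c(2) by blast
      moreover have "(\<lambda>j. if j < n then b ! j else s0) \<in> vals (insert s0 B\<^sub>0)"
        using b nth_mem[of _ b] by (auto simp: tuples_def vals_iff subset_iff)
      ultimately have "holds (struct_consts U) x' (\<phi>, b) \<longleftrightarrow> holds (struct_consts U) a (\<phi>, b)"
        unfolding P_holds using y(4) x' by blast
      then show ?thesis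
        using holds_cong[where a=x and a'=x', OF \<phi>] x'_x by simp
    qed
    show "\<exists>c\<in>tuples A m. holds (struct_consts U) a (\<chi>, c) \<and> implies_in (struct_consts U) I (\<chi>, c)
        ({(\<phi>, b) |b. b \<in> tuples B\<^sub>0 n \<and> holds (struct_consts U) a (\<phi>, b)} \<union>
         {(Neg \<phi>, b) |b. b \<in> tuples B\<^sub>0 n \<and> \<not> holds (struct_consts U) a (\<phi>, b)})"
    proof (intro bexI[OF _ c(1)] conjI)
      show "holds (struct_consts U) a (\<chi>, c)" using c(2) y(3) by simp
      show "implies_in (struct_consts U) I (\<chi>, c)
        ({(\<phi>, b) |b. b \<in> tuples B\<^sub>0 n \<and> holds (struct_consts U) a (\<phi>, b)} \<union>
         {(Neg \<phi>, b) |b. b \<in> tuples B\<^sub>0 n \<and> \<not> holds (struct_consts U) a (\<phi>, b)})"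
        unfolding implies_in_def struct_consts_simps
      proof (intro ballI impI)
        fix x \<sigma> assume x: "x \<in> I \<rightarrow> carrier U" "holds (struct_consts U) x (\<chi>, c)"
          and \<sigma>: "\<sigma> \<in> {(\<phi>, b) |b. b \<in> tuples B\<^sub>0 n \<and> holds (struct_consts U) a (\<phi>, b)} \<union>
            {(Neg \<phi>, b) |b. b \<in> tuples B\<^sub>0 n \<and> \<not> holds (struct_consts U) a (\<phi>, b)}"
        from \<sigma> show "holds (struct_consts U) x \<sigma>"
        proof
          assume "\<sigma> \<in> {(\<phi>, b) |b. b \<in> tuples B\<^sub>0 n \<and> holds (struct_consts U) a (\<phi>, b)}"
          then show ?thesis using dec[OF x] by auto
        next
          assume "\<sigma> \<in> {(Neg \<phi>, b) |b. b \<in> tuples B\<^sub>0 n \<and> \<not> holds (struct_consts U) a (\<phi>, b)}"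
          then obtain b where b: "\<sigma> = (Neg \<phi>, b)" "b \<in> tuples B\<^sub>0 n" "\<not> holds (struct_consts U) a (\<phi>, b)"
            by blast
          then have "\<not> holds (struct_consts U) x (\<phi>, b)" using dec[OF x] by blast
          then show ?thesis by (simp add: b(1) holds_def)
        qed
      qed
    qed
  qed
qed

end

section \<open>Values outside I, the empty base, and the conclusion\<close>

lemma compressible_cong:
  fixes M :: "('f, 'r, 'u) struct" and I :: "'i set"
  assumes "compressible L M I a B" "\<And>i. i \<in> I \<Longrightarrow> a i = a' i"
  shows "compressible L M I a' B"
  unfolding compressible_def
proof (intro allI impI)
  fix n and \<phi> :: "('f, 'r, 'i + nat) fm"
  assume \<phi>: "part_fm L I n \<phi>"
  have h: "holds M a (\<phi>, b) = holds M a' (\<phi>, b)" for b by (rule holds_cong[OF \<phi> assms(2)])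
  from assms(1)[unfolded compressible_def, rule_format, OF \<phi>] obtain m \<psi> where \<psi>: "part_fm L I m \<psi>" and
    *: "\<forall>B\<^sub>0. finite B\<^sub>0 \<and> B\<^sub>0 \<subseteq> B \<longrightarrow> (\<exists>c\<in>tuples B m. holds M a (\<psi>, c) \<and> implies_in M I (\<psi>, c)
      ({(\<phi>, b) |b. b \<in> tuples B\<^sub>0 n \<and> holds M a (\<phi>, b)} \<union> {(Neg \<phi>, b) |b. b \<in> tuples B\<^sub>0 n \<and> \<not> holds M a (\<phi>, b)}))"
    by (elim exE conjE) (rule that)
  have h': "holds M a (\<psi>, b) = holds M a' (\<psi>, b)" for b by (rule holds_cong[OF \<psi> assms(2)])
  show "\<exists>m \<psi>. part_fm L I m \<psi> \<and> (\<forall>B\<^sub>0. finite B\<^sub>0 \<and> B\<^sub>0 \<subseteq> B \<longrightarrow> (\<exists>c\<in>tuples B m. holds M a' (\<psi>, c) \<and> implies_in M I (\<psi>, c)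
      ({(\<phi>, b) |b. b \<in> tuples B\<^sub>0 n \<and> holds M a' (\<phi>, b)} \<union> {(Neg \<phi>, b) |b. b \<in> tuples B\<^sub>0 n \<and> \<not> holds M a' (\<phi>, b)})))"
    using \<psi> * unfolding h h' by (intro exI conjI)
qed

text \<open>Over the empty set the only parameter tuple is the empty one. For \<open>n = 0\<close>
  the formula or its negation, whichever \<open>a\<close> satisfies, decides its single instance;
  for \<open>n > 0\<close> there is nothing to decide and a true sentence suffices.\<close>

lemma compressible_empty:
  fixes M :: "('f, 'r, 'u) struct" and I :: "'i set"
  assumes ne: "carrier M \<noteq> {}"
  shows "compressible L M I a {}"
  unfolding compressible_def
proof (intro allI impI)
  fix n and \<phi> :: "('f, 'r, 'i + nat) fm"
  assume \<phi>: "part_fm L I n \<phi>"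
  define \<psi> where "\<psi> = (if n = 0 then if holds M a (\<phi>, []) then \<phi> else Neg \<phi>
    else Ex (Inr 0) (Eqn (Var (Inr 0)) (Var (Inr 0))))"
  have "part_fm L I 0 \<psi>" using \<phi> by (auto simp: \<psi>_def part_fm_def)
  moreover have "holds M a (\<psi>, [])" using ne by (auto simp: \<psi>_def holds_def)
  moreover have "implies_in M I (\<psi>, [])
      ({(\<phi>, b) |b. b \<in> tuples {} n \<and> holds M a (\<phi>, b)} \<union> {(Neg \<phi>, b) |b. b \<in> tuples {} n \<and> \<not> holds M a (\<phi>, b)})"
    by (auto simp: \<psi>_def implies_in_def tuples_def)
  moreover have "[] \<in> tuples {} 0" by (simp add: tuples_def)
  ultimately show "\<exists>m \<psi>. part_fm L I m \<psi> \<and> (\<forall>B\<^sub>0. finite B\<^sub>0 \<and> B\<^sub>0 \<subseteq> {} \<longrightarrow> (\<exists>c\<in>tuples {} m. holds M a (\<psi>, c) \<and> implies_in M I (\<psi>, c)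
      ({(\<phi>, b) |b. b \<in> tuples B\<^sub>0 n \<and> holds M a (\<phi>, b)} \<union> {(Neg \<phi>, b) |b. b \<in> tuples B\<^sub>0 n \<and> \<not> holds M a (\<phi>, b)})))"
    by (intro exI[of _ 0] exI[of _ \<psi>] conjI allI impI bexI[of _ "[]"]) (simp_all only: subset_empty)
qed

theorem proposition6p23:
  fixes L :: "('f, 'r) lang"
    and T :: "('f, 'r, nat) fm set"
    and U :: "('f, 'r, 'u) struct"
    and A B :: "'u set"
    and I :: "'i set"
    and a :: "'i \<Rightarrow> 'u"
  assumes "complete_theory L T"
    and "monster_model L T U"
    and "NIP L U"
    and "A \<subseteq> B" and "B \<subseteq> carrier U"
    and "small U A" and "small U B"
    and "small U I" and "a \<in> I \<rightarrow> carrier U"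
    and "compressible L U I a B"
  shows "compressible_up_to L U I a A B"
proof (cases "A = {}")
  case True
  have "carrier (struct_consts U) \<noteq> {}"
    using assms(2) by (simp add: monster_model_def is_model_def is_struct_def)
  then show ?thesis unfolding compressible_up_to_def True by (rule compressible_empty)
next
  case False
  then obtain u0 where u0: "u0 \<in> carrier U" using assms(4,5) by blast
  \<comment> \<open>The locale works with total tuples in the carrier, so \<open>a\<close> is
    extended outside \<open>I\<close>; compressibility depends only on its values on
    \<open>I\<close>.\<close>
  define a' where "a' i = (if i \<in> I then a i else u0)" for i
  have a': "\<And>i. i \<in> I \<Longrightarrow> a i = a' i" "\<And>i. i \<in> I \<Longrightarrow> a' i = a i" by (simp_all add: a'_def)
  interpret compressible_type L U I B A a'
  proof
    show "carrier U \<noteq> {}" using u0 by blast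
    show "a' \<in> vals (carrier U)" using assms(9) u0 by (auto simp: a'_def vals_iff)
    show "compressible L U I a' B" by (rule compressible_cong[OF assms(10) a'(1)])
  qed (use assms False in simp_all)
  show ?thesis
    using compressible_up_to_nonempty unfolding compressible_up_to_def
    by (rule compressible_cong) (rule a'(2))
qed

end
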